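(* Let $\alpha=(\alpha_1,\dots,\alpha_d)\in\mathbb{R}^d$ and consider the irrational translation flow on $\mathbb{T}^d$ with direction $\alpha$. Let $T:\mathbb{T}^d\to\mathbb{T}^d$ be the time-1 map of any reparametrization of this flow with positive speed. If some of the $\alpha_i$ has type $\gamma>d$, then the speed of decay of correlations of the system $(\mathbb{T}^d,T)$ is slower than a power law with exponent $\frac{2d+2}{\gamma-d}$, in the sense that if the system has decay of correlations with power law speed with exponent $p$, then $p\le\frac{2d+2}{\gamma-d}$ (where the right-hand side is $0$ if $\gamma=\infty$).
   Context: $\mathbb{T}^d=\mathbb{R}^d/\mathbb{Z}^d$ carries the sup distance $\max_i\|x_i-y_i\|$, where $\|t\|$ is the distance of $t\in\mathbb{R}$ from the nearest integer. The translation flow with direction $\alpha$ is the flow generated by the constant vector field $\alpha$; it is irrational if $\alpha_1,\dots,\alpha_d$ are rationally independent. A reparametrization with positive speed is the flow generated by $\dot x=\phi(x)\alpha$, where $\phi:\mathbb{T}^d\to\mathbb{R}$ is a smooth strictly positive function; it preserves the absolutely continuous measure with density $1/\phi$, and $\mu$ denotes this measure normalized to a probability, with which the system is equipped. The type of an irrational number $\beta$ is $\gamma(\beta)=\sup\{b:\liminf_{q\to\infty}q^{b}\|q\beta\|=0\}\in[1,\infty]$, where $q$ ranges over positive integers. A system $(X,T,\mu)$ with $\mu$ $T$-invariant has decay of correlations with power law speed with exponent $p$ if there exists $\Phi(n)$ such that for all Lipschitz observables $f,g:X\to\mathbb{R}$ and all $n$, $$\left|\int f\circ T^n\,g\,d\mu-\int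 f\,d\mu\int g\,d\mu\right|\le\|f\|\,\|g\|\,\Phi(n),$$ and $\lim_{n\to\infty}\frac{-\log\Phi(n)}{\log n}=p$; here $\|f\|$ and $\|g\|$ are Lipschitz norms. By convention, decay slower than any negative power law counts as a power law with exponent $0$. *)

theory Defs
  imports "HOL-Analysis.Analysis"
begin

definition dist_int :: "real \<Rightarrow> real" where
  "dist_int t = \<bar>t - of_int (round t)\<bar>"

lemma dist_int_le: "dist_int t \<le> \<bar>t - of_int m\<bar>"
  unfolding dist_int_def by (rule round_diff_minimal)

lemma dist_int_nonneg: "0 \<le> dist_int t"
  by (simp add: dist_int_def)

lemma dist_int_le_abs: "dist_int t \<le> \<bar>t\<bar>"
  using dist_int_le[of t 0] by simp

lemma dist_int_eq_0_iff: "dist_int t = 0 \<longleftrightarrow> t \<in> \<int>"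
proof
  assume "dist_int t = 0"
  then have "t = of_int (round t)" by (simp add: dist_int_def)
  then show "t \<in> \<int>" by (metis Ints_of_int)
next
  assume "t \<in> \<int>"
  then show "dist_int t = 0" by (auto simp: dist_int_def elim: Ints_cases)
qed

lemma dist_int_add_le: "dist_int (s + t) \<le> dist_int s + dist_int t"
  using dist_int_le[of "s + t" "round s + round t"] by (simp add: dist_int_def)

lemma dist_int_minus: "dist_int (- t) = dist_int t"
proof -
  have "dist_int (- s) \<le> dist_int s" for s
    using dist_int_le[of "- s" "- round s"] by (simp add: dist_int_def)
  from this[of t] this[of "- t"] show ?thesis by simp
qed

lemma dist_int_add_Int:
  assumes "a \<in> \<int>" shows "dist_int (t + a) = dist_int t"
proof (rule antisym)
  have "dist_int a = 0" "dist_int (- a) = 0"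
    using assms by (simp_all add: dist_int_eq_0_iff)
  then show "dist_int (t + a) \<le> dist_int t" "dist_int t \<le> dist_int (t + a)"
    using dist_int_add_le[of t a] dist_int_add_le[of "t + a" "- a"] by simp_all
qed

definition lattice_rel :: "real ^ 'n \<Rightarrow> real ^ 'n \<Rightarrow> bool" where
  "lattice_rel x y \<longleftrightarrow> (\<forall>i. x $ i - y $ i \<in> \<int>)"

lemma equivp_lattice_rel: "equivp lattice_rel"
proof (rule equivpI)
  show "reflp lattice_rel"
    by (auto simp: reflp_def lattice_rel_def)
  show "symp lattice_rel"
    unfolding symp_def lattice_rel_def by (metis Ints_minus minus_diff_eq)
  show "transp lattice_rel"
  proof (rule transpI)
    fix x y z :: "real ^ 'n"
    assume *: "lattice_rel x y" "lattice_rel y z"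
    have "x $ i - z $ i = (x $ i - y $ i) + (y $ i - z $ i)" for i by simp
    with * show "lattice_rel x z"
      unfolding lattice_rel_def by (metis Ints_add)
  qed
qed

quotient_type (overloaded) 'n torus = "real ^ ('n::finite)" / lattice_rel
  by (rule equivp_lattice_rel)

definition to_torus :: "real ^ ('n::finite) \<Rightarrow> 'n torus" where
  "to_torus = abs_torus"

lemma to_torus_eq_iff: "to_torus x = to_torus y \<longleftrightarrow> (\<forall>i. x $ i - y $ i \<in> \<int>)"
  unfolding to_torus_def by (simp add: torus.abs_eq_iff lattice_rel_def)

lemma to_torus_surj: obtains x where "z = to_torus x"
  unfolding to_torus_def by (metis Quotient3_abs_rep Quotient3_torus)

instantiation torus :: (finite) metric_space
begin

lift_definition dist_torus :: "'a torus \<Rightarrow> 'a torus \<Rightarrow> real"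
  is "\<lambda>x y. MAX i. dist_int (x $ i - y $ i)"
proof -
  fix x x' y y' :: "real ^ 'a"
  assume *: "lattice_rel x x'" "lattice_rel y y'"
  have "dist_int (x $ i - y $ i) = dist_int (x' $ i - y' $ i)" for i
  proof -
    have "(x $ i - x' $ i) - (y $ i - y' $ i) \<in> \<int>"
      using * unfolding lattice_rel_def by (metis Ints_diff)
    from dist_int_add_Int[OF this, of "x' $ i - y' $ i"] show ?thesis by simp
  qed
  then show "(MAX i. dist_int (x $ i - y $ i)) = (MAX i. dist_int (x' $ i - y' $ i))"
    by simp
qed

definition uniformity_torus :: "('a torus \<times> 'a torus) filter" where
  "uniformity_torus = (INF e\<in>{0<..}. principal {(x, y). dist x y < e})"

definition open_torus :: "'a torus set \<Rightarrow> bool" where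
  "open_torus U \<longleftrightarrow> (\<forall>x\<in>U. eventually (\<lambda>(x', y). x' = x \<longrightarrow> y \<in> U) uniformity)"

lemma dist_to_torus:
  "dist (to_torus x) (to_torus y) = (MAX i. dist_int (x $ i - y $ i))"
  unfolding to_torus_def by transfer simp

instance
proof
  fix x y z :: "'a torus"
  obtain a b c where abc: "x = to_torus a" "y = to_torus b" "z = to_torus c"
    using to_torus_surj by metis
  show "dist x y = 0 \<longleftrightarrow> x = y"
  proof
    assume "dist x y = 0"
    then have "(MAX i. dist_int (a $ i - b $ i)) \<le> 0"
      by (simp add: abc dist_to_torus)
    then have "dist_int (a $ i - b $ i) = 0" for i
      by (subst (asm) Max_le_iff) (auto intro!: antisym dist_int_nonneg)
    then show "x = y" by (simp add: abc to_torus_eq_iff dist_int_eq_0_iff)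
  next
    assume "x = y"
    then show "dist x y = 0" by (simp add: abc(2) dist_to_torus dist_int_def)
  qed
  show "dist x y \<le> dist x z + dist y z"
    unfolding abc dist_to_torus
  proof (subst Max_le_iff; safe?)
    fix i
    have "dist_int (a $ i - b $ i) \<le> dist_int (a $ i - c $ i) + dist_int (b $ i - c $ i)"
      using dist_int_add_le[of "a $ i - c $ i" "- (b $ i - c $ i)"]
      by (simp add: dist_int_minus del: minus_diff_eq)
    also have "dist_int (a $ i - c $ i) \<le> (MAX i. dist_int (a $ i - c $ i))" by simp
    also have "dist_int (b $ i - c $ i) \<le> (MAX i. dist_int (b $ i - c $ i))" by simp
    finally show "dist_int (a $ i - b $ i)
        \<le> (MAX i. dist_int (a $ i - c $ i)) + (MAX i. dist_int (b $ i - c $ i))"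
      by simp
  qed auto
qed (simp_all add: uniformity_torus_def open_torus_def)

end

lemma dist_to_torus_le: "dist (to_torus x) (to_torus y) \<le> dist x y"
  unfolding dist_to_torus
proof (subst Max_le_iff; safe?)
  fix i
  show "dist_int (x $ i - y $ i) \<le> dist x y"
    using dist_int_le_abs[of "x $ i - y $ i"] component_le_norm_cart[of "x - y" i]
    by (simp add: dist_norm)
qed auto

lemma continuous_to_torus: "continuous_on UNIV to_torus"
  unfolding continuous_on_iff using dist_to_torus_le le_less_trans by blast

lemma measurable_to_torus [measurable]: "to_torus \<in> borel_measurable borel"
  by (intro borel_measurable_continuous_onI continuous_to_torus)

definition unit_cube :: "(real ^ 'n) set" where
  "unit_cube = {x. \<forall>i. 0 \<le> x $ i \<and> x $ i < 1}"

definition torus_lebesgue :: "('n::finite) torus measure" where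
  "torus_lebesgue = distr (restrict_space lborel unit_cube) borel to_torus"

primrec Ck :: "nat \<Rightarrow> (real ^ 'n \<Rightarrow> real) \<Rightarrow> bool" where
  "Ck 0 f \<longleftrightarrow> continuous_on UNIV f"
| "Ck (Suc k) f \<longleftrightarrow>
    (\<exists>grad :: real ^ 'n \<Rightarrow> real ^ 'n.
      (\<forall>x. (f has_derivative (\<lambda>h. grad x \<bullet> h)) (at x)) \<and> (\<forall>i. Ck k (\<lambda>x. grad x $ i)))"

definition torus_smooth :: "(('n::finite) torus \<Rightarrow> real) \<Rightarrow> bool" where
  "torus_smooth \<phi> \<longleftrightarrow> (\<forall>k. Ck k (\<lambda>x. \<phi> (to_torus x)))"

definition rationally_independent :: "real ^ 'n \<Rightarrow> bool" where
  "rationally_independent \<alpha> \<longleftrightarrow>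
    (\<forall>k :: 'n \<Rightarrow> rat. (\<Sum>i\<in>UNIV. of_rat (k i) * \<alpha> $ i) = 0 \<longrightarrow> (\<forall>i. k i = 0))"

(* The tangent space at each point of the torus is identified with R^n; integral curves
   on the torus are the projections of integral curves of the lifted vector field. *)
definition generates_flow ::
    "(('n::finite) torus \<Rightarrow> real ^ 'n) \<Rightarrow> (real \<Rightarrow> 'n torus \<Rightarrow> 'n torus) \<Rightarrow> bool" where
  "generates_flow V F \<longleftrightarrow>
    (\<forall>x. \<exists>c :: real \<Rightarrow> real ^ 'n. c 0 = x \<and>
      (\<forall>t. (c has_vector_derivative V (to_torus (c t))) (at t)) \<and>
      (\<forall>t. F t (to_torus x) = to_torus (c t)))"

definition reparam_measure :: "(('n::finite) torus \<Rightarrow> real) \<Rightarrow> 'n torus measure" where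
  "reparam_measure \<phi> =
    density torus_lebesgue (\<lambda>x. ennreal ((1 / \<phi> x) / (\<integral>y. 1 / \<phi> y \<partial>torus_lebesgue)))"

(* Meant for irrational beta only. The term with q = 0 is irrelevant for the liminf. *)
definition irrational_type :: "real \<Rightarrow> ereal" where
  "irrational_type \<beta> =
    Sup {ereal b | b :: real.
      liminf (\<lambda>q::nat. ereal (real q powr b * dist_int (real q * \<beta>))) = 0}"

definition is_lipschitz :: "('a::metric_space \<Rightarrow> real) \<Rightarrow> bool" where
  "is_lipschitz f \<longleftrightarrow> (\<exists>L. L-lipschitz_on UNIV f)"

(* Sup norm plus least Lipschitz constant. The supremum is a genuine one because a
   Lipschitz function on the torus is bounded. *)
definition lipschitz_norm :: "(('n::finite) torus \<Rightarrow> real) \<Rightarrow> real" where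
  "lipschitz_norm f = (SUP x. \<bar>f x\<bar>) + Inf {L. L-lipschitz_on UNIV f}"

(* Requiring Phi > 0 loses nothing and avoids the junk value of ln at 0. The exponent 0
   also covers decay slower than any negative power: a large constant Phi always
   satisfies the inequality. *)
definition power_law_decay ::
    "('n::finite) torus measure \<Rightarrow> ('n torus \<Rightarrow> 'n torus) \<Rightarrow> ereal \<Rightarrow> bool" where
  "power_law_decay \<mu> T p \<longleftrightarrow>
    (\<exists>\<Phi> :: nat \<Rightarrow> real.
      (\<forall>n. 0 < \<Phi> n) \<and>
      (\<forall>f g n. is_lipschitz f \<longrightarrow> is_lipschitz g \<longrightarrow>
        \<bar>(\<integral>x. f ((T ^^ n) x) * g x \<partial>\<mu>) - (\<integral>x. f x \<partial>\<mu>) * (\<integral>x. g x \<partial>\<mu>)\<bar>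
          \<le> lipschitz_norm f * lipschitz_norm g * \<Phi> n) \<and>
      ((\<lambda>n. ereal (- ln (\<Phi> n) / ln (real n))) \<longlongrightarrow> p) sequentially)"

end

theory Submission
  imports Defs
begin

text \<open>The bound on the exponent is nonnegative, since \<open>\<gamma>\<close> exceeds the dimension.  It
therefore suffices that a smooth reparametrization of a translation flow never mixes at a positive
power rate.  Suppose it does, with respect to Lipschitz observables.  Two kinds of observables,
both of the form \<open>cis \<circ> \<theta>\<close> for a phase \<open>\<theta>\<close>, lead to a contradiction; the
estimate that treats them together is \<open>phase_correlation\<close>.

First, a character \<open>x \<mapsto> cis (2 \<pi> (k \<bullet> x))\<close> changes along the flow at a rate
proportional to \<open>k \<bullet> \<alpha>\<close>.  If this number were smaller than a sufficiently high
negative power of the norm of \<open>k\<close>, the character would still be practically unchanged at a time at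
which mixing must already have destroyed its correlation with itself.  Hence power-law mixing forces \<open>\<alpha>\<close> to satisfy a Diophantine
condition \<open>\<bar>k \<bullet> \<alpha>\<bar> \<ge> c \<bar>k\<bar> powr (- \<tau>)\<close> for all nonzero integer vectors
\<open>k\<close> (\<open>decay_imp_diophantine\<close>).

Second, under such a condition the flow is conjugate to a linear one.  Fourier series give a
Lipschitz function \<open>u\<close> whose derivative along \<open>\<alpha>\<close> is \<open>1 / \<phi> - m\<close>,
with \<open>m\<close> the mean of \<open>1 / \<phi>\<close> (\<open>cohomological_equation\<close>).  Along an
integral curve \<open>c\<close> of the reparametrized flow, the phase
\<open>2 \<pi> (k \<bullet> c + (k \<bullet> \<alpha>) / m * u(c))\<close> then has the constant derivative
\<open>2 \<pi> (k \<bullet> \<alpha>) / m\<close>.  This makes \<open>cis\<close> of it a nonconstant Lipschitz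
eigenfunction, whose correlations have constant modulus; see \<open>no_power_decay\<close>.

Most of the development supplies the harmonic analysis on the torus that the second step needs:
decay of Fourier coefficients of smooth functions, Fourier inversion, and summability over the
integer lattice.\<close>

section \<open>Periodic functions on Euclidean space as functions on the torus\<close>

definition lattice_periodic :: "(real ^ 'n \<Rightarrow> 'b) \<Rightarrow> bool" where
  "lattice_periodic h \<longleftrightarrow> (\<forall>x y. lattice_rel x y \<longrightarrow> h x = h y)"

definition descend :: "(real ^ 'n \<Rightarrow> 'b) \<Rightarrow> ('n::finite) torus \<Rightarrow> 'b" where
  "descend h z = h (SOME x. z = to_torus x)"

lemma to_torus_eq_iff_lattice_rel: "to_torus x = to_torus y \<longleftrightarrow> lattice_rel x y"
  by (simp add: to_torus_eq_iff lattice_rel_def)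

lemma lattice_periodicD: "lattice_periodic h \<Longrightarrow> lattice_rel x y \<Longrightarrow> h x = h y"
  by (simp add: lattice_periodic_def)

lemma descend_to_torus [simp]:
  assumes "lattice_periodic h"
  shows "descend h (to_torus x) = h x"
proof -
  have "to_torus x = to_torus (SOME y. to_torus x = to_torus y)"
    by (rule someI[of "\<lambda>y. to_torus x = to_torus y" x]) simp
  then have "lattice_rel (SOME y. to_torus x = to_torus y) x"
    by (metis to_torus_eq_iff_lattice_rel)
  with assms show ?thesis
    unfolding descend_def by (rule lattice_periodicD)
qed

lemma lattice_periodic_to_torus [simp]: "lattice_periodic (\<lambda>x. f (to_torus x))"
  by (auto simp: lattice_periodic_def to_torus_eq_iff_lattice_rel[symmetric])

lemma lattice_periodic_comp:
  "lattice_periodic h \<Longrightarrow> lattice_periodic (\<lambda>x. f (h x))"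
  unfolding lattice_periodic_def by metis

lemma lattice_periodic_comp2:
  "lattice_periodic h \<Longrightarrow> lattice_periodic k \<Longrightarrow> lattice_periodic (\<lambda>x. f (h x) (k x))"
  unfolding lattice_periodic_def by metis

lemma lattice_periodic_const [simp]: "lattice_periodic (\<lambda>x. c)"
  by (simp add: lattice_periodic_def)

lemma lattice_periodic_shift:
  "lattice_periodic h \<Longrightarrow> lattice_periodic (\<lambda>x. h (x + v))"
  unfolding lattice_periodic_def lattice_rel_def by (metis add_diff_cancel_right vector_add_component)

text \<open>A point and a representative of another one can be represented at Euclidean distance
  comparable to their distance on the torus: round the difference in each coordinate.  This is
  how estimates on Euclidean space pass to the torus.\<close>

lemma nearby_representative:
  fixes z :: "('n::finite) torus"
  obtains x where "z = to_torus x" "norm (x - y) \<le> real CARD('n) * dist z (to_torus y)"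
proof -
  obtain x0 where x0: "z = to_torus x0" by (rule to_torus_surj)
  define x where "x = (\<chi> i. x0 $ i - of_int (round (x0 $ i - y $ i)))"
  have z: "z = to_torus x"
    by (simp add: x0 to_torus_eq_iff x_def)
  have "norm (x - y) \<le> (\<Sum>i\<in>UNIV. \<bar>(x - y) $ i\<bar>)"
    by (rule norm_le_l1_cart)
  also have "\<dots> = (\<Sum>i\<in>UNIV. dist_int (x0 $ i - y $ i))"
    by (intro sum.cong) (auto simp: x_def dist_int_def algebra_simps)
  also have "\<dots> \<le> (\<Sum>i\<in>(UNIV::'n set). dist z (to_torus y))"
    unfolding x0 dist_to_torus by (intro sum_mono Max_ge) auto
  finally have "norm (x - y) \<le> real CARD('n) * dist z (to_torus y)" by simp
  with z show thesis by (rule that)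
qed

lemma lipschitz_on_torusI:
  fixes f :: "('n::finite) torus \<Rightarrow> 'b::metric_space"
  assumes "L-lipschitz_on UNIV (\<lambda>x. f (to_torus x))"
  shows "(real CARD('n) * L)-lipschitz_on UNIV f"
proof (rule lipschitz_onI)
  show "0 \<le> real CARD('n) * L"
    using lipschitz_on_nonneg[OF assms] by simp
  fix z w :: "'n torus"
  obtain y where y: "w = to_torus y" by (rule to_torus_surj)
  obtain x where x: "z = to_torus x" "norm (x - y) \<le> real CARD('n) * dist z (to_torus y)"
    by (rule nearby_representative)
  have "dist (f z) (f w) \<le> L * dist x y"
    using lipschitz_onD[OF assms, of x y] by (simp add: x y)
  also have "\<dots> \<le> L * (real CARD('n) * dist z w)"
    using x(2) lipschitz_on_nonneg[OF assms] by (intro mult_left_mono) (auto simp: dist_norm y)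
  finally show "dist (f z) (f w) \<le> real CARD('n) * L * dist z w" by (simp add: mult_ac)
qed

lemma continuous_on_torusI:
  fixes f :: "('n::finite) torus \<Rightarrow> 'b::metric_space"
  assumes "continuous_on UNIV (\<lambda>x. f (to_torus x))"
  shows "continuous_on UNIV f"
  unfolding continuous_on_iff
proof safe
  fix w :: "'n torus" and e :: real assume "0 < e"
  obtain y where y: "w = to_torus y" by (rule to_torus_surj)
  obtain d where d: "d > 0" "\<And>x. dist x y < d \<Longrightarrow> dist (f (to_torus x)) (f (to_torus y)) < e"
    using assms \<open>0 < e\<close> unfolding continuous_on_iff by (metis UNIV_I)
  show "\<exists>d>0. \<forall>z\<in>UNIV. dist z w < d \<longrightarrow> dist (f z) (f w) < e"
  proof (intro exI[of _ "d / real CARD('n)"] conjI ballI impI)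
    show "0 < d / real CARD('n)" using d(1) by simp
    fix z assume z: "dist z w < d / real CARD('n)"
    obtain x where x: "z = to_torus x" "norm (x - y) \<le> real CARD('n) * dist z (to_torus y)"
      by (rule nearby_representative)
    have "dist x y < d"
      using x(2) z by (simp add: y dist_norm field_simps)
    then show "dist (f z) (f w) < e" using d(2) by (simp add: x y)
  qed
qed

lemma unit_cube_representative:
  fixes x :: "real ^ 'n"
  obtains y where "y \<in> unit_cube" "lattice_rel x y"
proof -
  define y where "y = (\<chi> i. frac (x $ i))"
  have "y \<in> unit_cube" by (auto simp: unit_cube_def y_def frac_lt_1)
  moreover have "lattice_rel x y" by (auto simp: lattice_rel_def y_def frac_def)
  ultimately show thesis by (rule that)
qed

lemma unit_cube_subset_cbox: "unit_cube \<subseteq> cbox 0 (\<chi> i. (1::real))"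
  by (auto simp: unit_cube_def mem_box_cart less_imp_le)

lemma compact_torus: "compact (UNIV :: ('n::finite) torus set)"
proof -
  have "UNIV = to_torus ` cbox 0 (\<chi> i::'n. (1::real))"
  proof (intro equalityI subsetI)
    fix z :: "'n torus"
    obtain x where x: "z = to_torus x" by (rule to_torus_surj)
    obtain y where "y \<in> unit_cube" "lattice_rel x y" by (rule unit_cube_representative)
    then show "z \<in> to_torus ` cbox 0 (\<chi> i::'n. (1::real))"
      using unit_cube_subset_cbox x to_torus_eq_iff_lattice_rel by blast
  qed simp
  then show ?thesis
    by (metis compact_continuous_image compact_cbox continuous_on_subset continuous_to_torus subset_UNIV)
qed

lemma periodic_bounded:
  fixes h :: "real ^ ('n::finite) \<Rightarrow> 'b::real_normed_vector"
  assumes "lattice_periodic h" "continuous_on UNIV h"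
  obtains B where "B > 0" "\<And>x. norm (h x) \<le> B"
proof -
  have "bounded (h ` cbox 0 (\<chi> i. 1))"
    by (intro compact_imp_bounded compact_continuous_image compact_cbox
        continuous_on_subset[OF assms(2)]) simp
  then obtain B where B: "B > 0" "\<And>x. x \<in> cbox 0 (\<chi> i. 1) \<Longrightarrow> norm (h x) \<le> B"
    by (auto simp: bounded_pos)
  have "norm (h x) \<le> B" for x
    by (metis B(2) assms(1) lattice_periodicD subsetD unit_cube_representative unit_cube_subset_cbox)
  with B(1) show thesis by (rule that)
qed

section \<open>Integration over a fundamental cell\<close>

abbreviation cell :: "(real ^ ('n::finite)) measure" where
  "cell \<equiv> restrict_space lborel unit_cube"

lemma unit_cube_sets [measurable]: "(unit_cube :: (real ^ ('n::finite)) set) \<in> sets borel"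
proof -
  have "unit_cube = (\<Inter>i::'n. {x :: real ^ 'n. 0 \<le> x $ i \<and> x $ i < 1})"
    by (auto simp: unit_cube_def)
  also have "\<dots> \<in> sets borel" by measurable
  finally show ?thesis .
qed

lemma box_subset_unit_cube: "box 0 (\<chi> i. (1::real)) \<subseteq> unit_cube"
  by (auto simp: unit_cube_def mem_box_cart less_imp_le)

lemma emeasure_unit_cube: "emeasure lborel (unit_cube :: (real ^ ('n::finite)) set) = 1"
proof (rule antisym)
  have 1: "emeasure lborel (cbox 0 (\<chi> i::'n. (1::real))) = 1"
    "emeasure lborel (box 0 (\<chi> i::'n. (1::real))) = 1"
    by (simp_all add: emeasure_lborel_cbox_eq emeasure_lborel_box_eq Basis_vec_def inner_axis
        prod.neutral)
  show "emeasure lborel (unit_cube :: (real ^ 'n) set) \<le> 1"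
    using emeasure_mono[OF unit_cube_subset_cbox[where ?'a='n], of lborel] 1 by simp
  show "1 \<le> emeasure lborel (unit_cube :: (real ^ 'n) set)"
    using emeasure_mono[OF box_subset_unit_cube[where ?'a='n], of lborel] 1 by simp
qed

lemma space_cell [simp]: "space cell = unit_cube"
  by (simp add: space_restrict_space)

interpretation cell: finite_measure "cell :: (real ^ ('n::finite)) measure"
  by (rule finite_measureI) (simp add: emeasure_restrict_space emeasure_unit_cube)

lemma measure_cell [simp]: "measure (cell :: (real ^ ('n::finite)) measure) unit_cube = 1"
  by (subst measure_restrict_space) (auto simp: measure_def emeasure_unit_cube)

lemma borel_measurable_cell:
  fixes h :: "real ^ ('n::finite) \<Rightarrow> 'b::topological_space"
  assumes "continuous_on UNIV h"
  shows "h \<in> borel_measurable cell"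
  using borel_measurable_continuous_onI[OF assms] by (intro measurable_restrict_space1) simp

lemma integrable_cell [intro]:
  fixes h :: "real ^ ('n::finite) \<Rightarrow> 'b::{banach, second_countable_topology}"
  assumes "lattice_periodic h" "continuous_on UNIV h"
  shows "integrable cell h"
proof -
  obtain B where "\<And>x. norm (h x) \<le> B" using periodic_bounded[OF assms] by metis
  then show ?thesis
    by (intro cell.integrable_const_bound[of _ B] borel_measurable_cell assms) auto
qed

lemma norm_integral_cell_le:
  fixes h :: "real ^ ('n::finite) \<Rightarrow> 'b::{banach, second_countable_topology}"
  assumes "lattice_periodic h" "continuous_on UNIV h" "\<And>x. norm (h x) \<le> B"
  shows "norm (integral\<^sup>L cell h) \<le> B"
proof -
  have "norm (integral\<^sup>L cell h) \<le> (\<integral>x. norm (h x) \<partial>cell)" by simp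
  also have "\<dots> \<le> integral\<^sup>L (cell :: (real ^ 'n) measure) (\<lambda>x. B)"
    by (rule Bochner_Integration.integral_mono)
      (use assms in \<open>auto intro!: integrable_norm integrable_cell\<close>)
  finally show ?thesis by simp
qed

text \<open>Vanishing almost everywhere on the open cell gives vanishing on its closure by continuity, and
then everywhere by periodicity.\<close>

lemma integral_cell_eq_0_imp_eq_0:
  fixes h :: "real ^ ('n::finite) \<Rightarrow> real"
  assumes h: "lattice_periodic h" "continuous_on UNIV h" and nonneg: "\<And>x. 0 \<le> h x"
    and "integral\<^sup>L cell h = 0"
  shows "h x = 0"
proof -
  have "AE x in cell. h x = 0"
    using integral_nonneg_eq_0_iff_AE[OF integrable_cell[OF h]] nonneg assms(4) by auto
  then have "AE x in lborel. x \<in> unit_cube \<longrightarrow> h x = 0"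
    by (subst (asm) AE_restrict_space_iff) auto
  then have "AE x in lebesgue. x \<in> unit_cube \<longrightarrow> h x = 0"
    by (rule AE_completion)
  then have ae: "AE x \<in> box 0 (\<chi> i. 1) in lebesgue. x \<in> {x. h x = 0}"
    using box_subset_unit_cube by (auto elim!: eventually_mono)
  have cl: "closed {x. h x = 0}"
    using h(2) by (intro closed_Collect_eq) auto
  have "box 0 (\<chi> i. 1) \<subseteq> {x. h x = 0}"
    using mem_closed_if_AE_lebesgue_open[OF open_box cl ae] by blast
  then have "closure (box 0 (\<chi> i. 1)) \<subseteq> {x. h x = 0}"
    using cl by (rule closure_minimal)
  moreover have "box 0 (\<chi> i::'n. (1::real)) \<noteq> {}"
    by (simp add: interval_ne_empty_cart)
  ultimately have "cbox 0 (\<chi> i. 1) \<subseteq> {x. h x = 0}"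
    by (simp add: closure_box)
  then show ?thesis
    by (metis (mono_tags, lifting) h(1) lattice_periodicD mem_Collect_eq subsetD
        unit_cube_representative unit_cube_subset_cbox)
qed

text \<open>Translating by \<open>t\<close> in one coordinate moves the cell; the part that leaves it comes
  back, by periodicity, after subtracting a unit vector.\<close>

lemma integral_cell_translate:
  fixes h :: "real ^ ('n::finite) \<Rightarrow> 'b::{banach, second_countable_topology}"
  assumes h: "lattice_periodic h" "continuous_on UNIV h" and t: "0 \<le> t" "t \<le> 1"
  shows "(\<integral>x. h (x + axis i t) \<partial>cell) = integral\<^sup>L cell h"
proof -
  define A where "A = {x \<in> unit_cube. t \<le> x $ i}"
  define B where "B = {x \<in> unit_cube. x $ i < t}"
  have [measurable]: "A \<in> sets borel" "B \<in> sets borel" unfolding A_def B_def by measurable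
  have hm [measurable]: "h \<in> borel_measurable borel"
    by (rule borel_measurable_continuous_onI[OF h(2)])
  have e1: "x - axis i t \<in> unit_cube \<longleftrightarrow> x \<in> A \<or> x - axis i 1 \<in> B" for x
  proof -
    have "(x - axis i s) $ j = (if j = i then x $ i - s else x $ j)" for j s
      by (simp add: axis_def)
    then show ?thesis
      using t unfolding A_def B_def unit_cube_def
      by (auto simp del: vector_minus_component split: if_splits; smt (verit))
  qed
  have e2: "\<not> (x \<in> A \<and> x - axis i 1 \<in> B)" for x
  proof
    assume x: "x \<in> A \<and> x - axis i 1 \<in> B"
    then have "0 \<le> (x - axis i 1) $ i" "x $ i < 1"
      by (auto simp: A_def B_def unit_cube_def simp del: vector_minus_component)
    then show False by simp
  qed
  have intC: "integrable lborel (\<lambda>x. indicator S x *\<^sub>R h x)"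
    if S: "S \<subseteq> unit_cube" and [measurable]: "S \<in> sets borel" for S
  proof -
    have "integrable lborel (\<lambda>x. indicator unit_cube x *\<^sub>R h x)"
      using integrable_cell[OF h] by (subst (asm) integrable_restrict_space) auto
    then show ?thesis
      by (rule Bochner_Integration.integrable_bound) (use S in \<open>auto simp: indicator_def\<close>)
  qed
  have intA: "integrable lborel (\<lambda>x. indicator A x *\<^sub>R h x)"
   and intB: "integrable lborel (\<lambda>x. indicator B x *\<^sub>R h x)"
    by (rule intC; auto simp: A_def B_def)+
  have shift: "(\<integral>x. f (x - v) \<partial>lborel) = integral\<^sup>L lborel f"
    if [measurable]: "f \<in> borel_measurable borel"
    for f :: "real ^ 'n \<Rightarrow> 'b" and v
  proof -
    have "integral\<^sup>L lborel f = integral\<^sup>L (distr lborel borel ((+) (- v))) f"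
      by (simp add: lborel_distr_plus)
    also have "\<dots> = (\<integral>x. f (- v + x) \<partial>lborel)" by (rule integral_distr) auto
    finally show ?thesis by simp
  qed
  have hB: "h (x - axis i 1) = h x" for x
    using h(1) by (auto intro!: lattice_periodicD simp: lattice_rel_def axis_def)
  have "integrable lborel (\<lambda>x. indicator B (x - axis i 1) *\<^sub>R h (x - axis i 1))"
    using intB lborel_integrable_real_affine_iff
    by (subst (asm) lborel_distr_plus[of "- axis i (1::real)", symmetric])
       (subst (asm) integrable_distr_eq, auto)
  then have intB': "integrable lborel (\<lambda>x. indicator B (x - axis i 1) *\<^sub>R h x)"
    by (simp add: hB)
  have "(\<integral>x. h (x + axis i t) \<partial>cell)
      = (\<integral>x. indicator unit_cube x *\<^sub>R h (x + axis i t) \<partial>lborel)"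
    by (subst integral_restrict_space) auto
  also have "\<dots> = (\<integral>x. indicator unit_cube (x - axis i t) *\<^sub>R h (x - axis i t + axis i t) \<partial>lborel)"
    by (rule shift[symmetric]) measurable
  also have "\<dots> = (\<integral>x. indicator A x *\<^sub>R h x + indicator B (x - axis i 1) *\<^sub>R h x \<partial>lborel)"
    using e1 e2 by (intro Bochner_Integration.integral_cong) (auto simp: indicator_def)
  also have "\<dots> = (\<integral>x. indicator A x *\<^sub>R h x \<partial>lborel) + (\<integral>x. indicator B (x - axis i 1) *\<^sub>R h x \<partial>lborel)"
    using intA intB' by (rule Bochner_Integration.integral_add)
  also have "(\<integral>x. indicator B (x - axis i 1) *\<^sub>R h x \<partial>lborel)
      = (\<integral>x. indicator B (x - axis i 1) *\<^sub>R h (x - axis i 1) \<partial>lborel)"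
    by (simp add: hB)
  also have "\<dots> = (\<integral>x. indicator B x *\<^sub>R h x \<partial>lborel)"
    by (rule shift) measurable
  also have "(\<integral>x. indicator A x *\<^sub>R h x \<partial>lborel) + (\<integral>x. indicator B x *\<^sub>R h x \<partial>lborel)
      = (\<integral>x. indicator A x *\<^sub>R h x + indicator B x *\<^sub>R h x \<partial>lborel)"
    using intA intB by (rule Bochner_Integration.integral_add[symmetric])
  also have "\<dots> = (\<integral>x. indicator unit_cube x *\<^sub>R h x \<partial>lborel)"
    by (intro Bochner_Integration.integral_cong) (auto simp: indicator_def A_def B_def)
  also have "\<dots> = integral\<^sup>L cell h"
    by (subst integral_restrict_space) auto
  finally show ?thesis .
qed

section \<open>Functions of class \<open>C\<^sup>k\<close>\<close>

lemma Ck_Suc_imp_Ck: "Ck (Suc k) f \<Longrightarrow> Ck k f"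
proof (induction k arbitrary: f)
  case 0
  then obtain g where "\<And>x. (f has_derivative (\<lambda>h. g x \<bullet> h)) (at x)" by auto
  then have "continuous_on UNIV f"
    by (intro has_derivative_continuous_on[where f' = "\<lambda>x h. g x \<bullet> h"]) auto
  then show ?case by simp
next
  case (Suc k)
  then obtain g where "\<forall>x. (f has_derivative (\<lambda>h. g x \<bullet> h)) (at x)" "\<forall>i. Ck (Suc k) (\<lambda>x. g x $ i)"
    by (subst (asm) Ck.simps(2)) blast
  with Suc.IH show ?case by (subst Ck.simps(2)) blast
qed

lemma Ck_imp_continuous: "Ck k f \<Longrightarrow> continuous_on UNIV f"
  by (induction k) (use Ck_Suc_imp_Ck in \<open>auto simp del: Ck.simps(2)\<close>)

lemma Ck_const: "Ck k (\<lambda>x. c)"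
proof (induction k arbitrary: c)
  case (Suc k)
  then show ?case
    unfolding Ck.simps(2)
    by (intro exI[of _ "\<lambda>_. 0"]) (auto simp: inner_zero_left[abs_def])
qed auto

lemma Ck_add: "Ck k f \<Longrightarrow> Ck k g \<Longrightarrow> Ck k (\<lambda>x. f x + g x)"
proof (induction k arbitrary: f g)
  case (Suc k)
  then obtain f' g'
    where *: "\<forall>x. (f has_derivative (\<lambda>h. f' x \<bullet> h)) (at x)" "\<forall>i. Ck k (\<lambda>x. f' x $ i)"
      and **: "\<forall>x. (g has_derivative (\<lambda>h. g' x \<bullet> h)) (at x)" "\<forall>i. Ck k (\<lambda>x. g' x $ i)"
    by auto
  have "((\<lambda>x. f x + g x) has_derivative (\<lambda>h. (f' x + g' x) \<bullet> h)) (at x)" for x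
    using has_derivative_add[OF *(1)[rule_format, of x] **(1)[rule_format, of x]]
    by (simp only: inner_add_left)
  then show ?case
    unfolding Ck.simps(2) using Suc.IH *(2) **(2)
    by (intro exI[of _ "\<lambda>x. f' x + g' x"]) auto
qed (auto intro: continuous_intros)

lemma Ck_mult: "Ck k f \<Longrightarrow> Ck k g \<Longrightarrow> Ck k (\<lambda>x. f x * g x)"
proof (induction k arbitrary: f g)
  case (Suc k)
  then obtain f' g'
    where *: "\<forall>x. (f has_derivative (\<lambda>h. f' x \<bullet> h)) (at x)" "\<forall>i. Ck k (\<lambda>x. f' x $ i)"
      and **: "\<forall>x. (g has_derivative (\<lambda>h. g' x \<bullet> h)) (at x)" "\<forall>i. Ck k (\<lambda>x. g' x $ i)"
    by auto
  have "((\<lambda>x. f x * g x) has_derivative (\<lambda>h. (f x *\<^sub>R g' x + g x *\<^sub>R f' x) \<bullet> h)) (at x)" for x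
    using has_derivative_mult[OF *(1)[rule_format, of x] **(1)[rule_format, of x]]
    by (simp add: inner_add_left mult.commute)
  moreover have "Ck k (\<lambda>x. (f x *\<^sub>R g' x + g x *\<^sub>R f' x) $ i)" for i
    using *(2) **(2) Suc.prems[THEN Ck_Suc_imp_Ck]
    by (auto intro!: Ck_add Suc.IH)
  ultimately show ?case
    unfolding Ck.simps(2) by (intro exI[of _ "\<lambda>x. f x *\<^sub>R g' x + g x *\<^sub>R f' x"]) auto
qed (auto intro: continuous_intros)

lemma Ck_inverse: "Ck k f \<Longrightarrow> (\<And>x. f x \<noteq> 0) \<Longrightarrow> Ck k (\<lambda>x. inverse (f x))"
proof (induction k arbitrary: f)
  case (Suc k)
  then obtain f'
    where *: "\<forall>x. (f has_derivative (\<lambda>h. f' x \<bullet> h)) (at x)" "\<forall>i. Ck k (\<lambda>x. f' x $ i)"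
    by auto
  define d where "d x = (- 1 * (inverse (f x) * inverse (f x))) *\<^sub>R f' x" for x
  have "((\<lambda>x. inverse (f x)) has_derivative (\<lambda>h. d x \<bullet> h)) (at x)" for x
    using Deriv.has_derivative_inverse[OF Suc.prems(2)[of x] *(1)[rule_format, of x]]
    by (simp add: d_def mult_ac)
  moreover have "Ck k (\<lambda>x. inverse (f x))"
    using Suc.prems by (intro Suc.IH) (auto dest: Ck_Suc_imp_Ck simp del: Ck.simps)
  then have "Ck k (\<lambda>x. d x $ i)" for i
    unfolding d_def vector_scaleR_component real_scaleR_def
    by (intro Ck_mult Ck_const *(2)[rule_format])
  ultimately show ?case
    unfolding Ck.simps(2) by (intro exI[of _ d]) auto
qed (auto intro!: continuous_intros)

text \<open>A lattice translate of \<open>f\<close> is \<open>f\<close> itself, and derivatives are unique.\<close>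

lemma lattice_periodic_gradient:
  fixes f :: "real ^ 'n \<Rightarrow> real"
  assumes "lattice_periodic f" and der: "\<And>x. (f has_derivative (\<lambda>h. g x \<bullet> h)) (at x)"
  shows "lattice_periodic g"
  unfolding lattice_periodic_def
proof (intro allI impI)
  fix x y :: "real ^ 'n" assume xy: "lattice_rel x y"
  have "f (z + (y - x)) = f z" for z
    using xy by (intro lattice_periodicD[OF assms(1)])
      (auto simp: lattice_rel_def intro: Ints_minus[of "_ - _", simplified])
  then have eq: "(\<lambda>z. f (z + (y - x))) = f" by auto
  have "((\<lambda>z. f (z + (y - x))) has_derivative (\<lambda>h. g y \<bullet> h)) (at x)"
    by (rule has_derivative_compose[where g = f, of "\<lambda>z. z + (y - x)" "\<lambda>h. h", simplified])
       (auto intro!: derivative_eq_intros der)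
  then have "(\<lambda>h. g x \<bullet> h) = (\<lambda>h. g y \<bullet> h)"
    unfolding eq by (rule has_derivative_unique[OF der])
  then show "g x = g y"
    by (metis vector_eq_rdot inner_commute)
qed

lemma Ck_Suc_imp_lipschitz:
  fixes f :: "real ^ ('n::finite) \<Rightarrow> real"
  assumes "lattice_periodic f" "Ck (Suc 0) f"
  obtains L where "L-lipschitz_on UNIV f"
proof -
  obtain g where g: "\<And>x. (f has_derivative (\<lambda>h. g x \<bullet> h)) (at x)"
    "\<And>i. continuous_on UNIV (\<lambda>x. g x $ i)"
    using assms(2) by auto
  have "continuous_on UNIV (\<lambda>x. \<chi> i. g x $ i)"
    by (intro continuous_intros g)
  then have "continuous_on UNIV g" by simp
  then obtain B where B: "B > 0" "\<And>x. norm (g x) \<le> B"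
    using periodic_bounded[OF lattice_periodic_gradient[OF assms(1) g(1)]] by metis
  have "B-lipschitz_on UNIV f"
  proof (rule bounded_derivative_imp_lipschitz)
    show "(f has_derivative (\<lambda>h. g x \<bullet> h)) (at x within UNIV)" for x using g(1) by simp
    show "onorm (\<lambda>h. g x \<bullet> h) \<le> B" for x
    proof (rule onorm_le)
      fix h
      have "norm (g x \<bullet> h) \<le> norm (g x) * norm h" using Cauchy_Schwarz_ineq2 by simp
      also have "\<dots> \<le> B * norm h" using B by (intro mult_right_mono) auto
      finally show "norm (g x \<bullet> h) \<le> B * norm h" .
    qed
  qed (use B in auto)
  then show thesis by (rule that)
qed

section \<open>Characters and Fourier coefficients\<close>

definition freq :: "int ^ 'n \<Rightarrow> real ^ 'n" where
  "freq k = (\<chi> i. of_int (k $ i))"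

definition character :: "int ^ 'n \<Rightarrow> real ^ ('n::finite) \<Rightarrow> complex" where
  "character k x = cis (2 * pi * (freq k \<bullet> x))"

definition fourier_coeff :: "(real ^ ('n::finite) \<Rightarrow> complex) \<Rightarrow> int ^ 'n \<Rightarrow> complex" where
  "fourier_coeff h k = (\<integral>x. h x * character (- k) x \<partial>cell)"

lemma freq_simps [simp]: "freq 0 = 0" "freq (- k) = - freq k" "freq (k + l) = freq k + freq l"
  by (simp_all add: freq_def vec_eq_iff)

lemma freq_nth [simp]: "freq k $ i = of_int (k $ i)"
  by (simp add: freq_def)

lemma character_0 [simp]: "character 0 x = 1"
  by (simp add: character_def)

lemma norm_character [simp]: "norm (character k x) = 1"
  by (simp add: character_def)

lemma character_add_freq: "character (k + l) x = character k x * character l x"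
  by (simp add: character_def inner_add_left cis_mult distrib_left)

lemma character_add_point: "character k (x + y) = character k x * character k y"
  by (simp add: character_def inner_add_right cis_mult distrib_left)

lemma continuous_on_character [continuous_intros]: "continuous_on UNIV (character k)"
  unfolding character_def by (intro continuous_intros)

lemma inner_freq_Ints:
  assumes "lattice_rel x y"
  shows "freq k \<bullet> x - freq k \<bullet> y \<in> \<int>"
proof -
  have "freq k \<bullet> x - freq k \<bullet> y = (\<Sum>i\<in>UNIV. of_int (k $ i) * (x $ i - y $ i))"
    by (simp add: inner_vec_def sum_subtractf right_diff_distrib)
  also have "\<dots> \<in> \<int>"
    using assms by (intro Ints_sum Ints_mult) (auto simp: lattice_rel_def)
  finally show ?thesis .
qed

lemma cis_2pi_eqI: "s - t \<in> \<int> \<Longrightarrow> cis (2 * pi * s) = cis (2 * pi * t)"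
proof -
  assume "s - t \<in> \<int>"
  have "cis (2 * pi * s) = cis (2 * pi * (s - t)) * cis (2 * pi * t)"
    by (simp add: cis_mult algebra_simps)
  also have "cis (2 * pi * (s - t)) = 1"
    using \<open>s - t \<in> \<int>\<close> by (intro cis_multiple_2pi)
  finally show ?thesis by simp
qed

lemma lattice_periodic_character [simp]: "lattice_periodic (character k)"
  unfolding lattice_periodic_def character_def
  by (auto intro!: cis_2pi_eqI inner_freq_Ints)

lemma periodic_continuous_times_character:
  assumes "lattice_periodic h" "continuous_on UNIV h"
  shows "lattice_periodic (\<lambda>x. h x * character k x)" "continuous_on UNIV (\<lambda>x. h x * character k x)"
  using assms by (auto intro!: lattice_periodic_comp2[where f = "(*)"] continuous_intros)

lemma integral_character:
  fixes k :: "int ^ ('n::finite)"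
  shows "integral\<^sup>L cell (character k) = (if k = 0 then 1 else 0)"
proof (cases "k = 0")
  case True
  then have "character k = (\<lambda>x. 1)" by (simp add: fun_eq_iff)
  with True show ?thesis by simp
next
  case False
  then obtain i where i: "k $ i \<noteq> 0" by (auto simp: vec_eq_iff)
  define t where "t = 1 / (2 * \<bar>real_of_int (k $ i)\<bar>)"
  have t: "0 \<le> t" "t \<le> 1" using i by (auto simp: t_def field_simps)
  \<comment> \<open>translating by half a period changes the sign\<close>
  have "character k (axis i t) = - 1"
    using i by (cases "k $ i > 0")
      (auto simp: character_def t_def inner_axis abs_if complex_eq_iff field_simps)
  then have "character k (x + axis i t) = - character k x" for x
    by (simp add: character_add_point)
  then have "- integral\<^sup>L cell (character k) = integral\<^sup>L cell (character k)"
    using integral_cell_translate[of "character k" t i] t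
    by (simp add: continuous_on_character)
  with False show ?thesis by simp
qed

lemma norm_fourier_coeff_le:
  assumes "lattice_periodic h" "continuous_on UNIV h" "\<And>x. norm (h x) \<le> B"
  shows "norm (fourier_coeff h k) \<le> B"
  unfolding fourier_coeff_def
  by (rule norm_integral_cell_le)
     (use assms periodic_continuous_times_character[of h] in \<open>auto simp: norm_mult\<close>)

lemma fourier_coeff_diff:
  assumes "lattice_periodic f" "continuous_on UNIV f" "lattice_periodic g" "continuous_on UNIV g"
  shows "fourier_coeff (\<lambda>x. f x - g x) k = fourier_coeff f k - fourier_coeff g k"
  unfolding fourier_coeff_def left_diff_distrib
  by (intro Bochner_Integration.integral_diff integrable_cell periodic_continuous_times_character assms)

text \<open>Integration by parts without boundary terms: translating \<open>f\<close> multiplies its Fourier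
  coefficients by values of the character, and the limit of difference quotients of this identity
  is taken by dominated convergence.\<close>

lemma fourier_coeff_partial_derivative:
  fixes f :: "real ^ ('n::finite) \<Rightarrow> real"
  assumes f: "lattice_periodic f" and der: "\<And>x. (f has_derivative (\<lambda>h. g x \<bullet> h)) (at x)"
    and cont: "continuous_on UNIV (\<lambda>x. g x $ i)"
  shows "fourier_coeff (\<lambda>x. of_real (g x $ i)) k
    = 2 * pi * \<i> * of_int (k $ i) * fourier_coeff (\<lambda>x. of_real (f x)) k"
proof -
  define s :: "nat \<Rightarrow> real" where "s n = inverse (real (Suc n))" for n
  have s: "0 < s n" "s n \<le> 1" for n by (auto simp: s_def field_simps)
  have s0: "s \<longlonglongrightarrow> 0" unfolding s_def by (rule LIMSEQ_inverse_real_of_nat)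
  then have s_at: "filterlim s (at 0) sequentially"
    using s by (auto simp: filterlim_at intro!: always_eventually less_imp_neq[symmetric])
  have fc: "continuous_on UNIV f"
    using der by (intro has_derivative_continuous_on[where f' = "\<lambda>x h. g x \<bullet> h"]) auto
  have gp: "lattice_periodic (\<lambda>x. g x $ i)"
    using lattice_periodic_gradient[OF f der] by (rule lattice_periodic_comp)
  obtain B where B: "B > 0" "\<And>x. norm (g x $ i) \<le> B"
    using periodic_bounded[OF gp cont] by metis
  define q where "q n x = (f (x + axis i (s n)) - f x) / s n" for n x
  define c where "c = fourier_coeff (\<lambda>x. of_real (f x)) k"
  have line: "((\<lambda>t. f (x + axis i t)) has_real_derivative (g (x + axis i t) $ i)) (at t)" for x t
  proof -
    have "((\<lambda>t. x + t *\<^sub>R axis i 1) has_derivative (\<lambda>h. h *\<^sub>R axis i 1)) (at t)"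
      by (auto intro!: derivative_eq_intros)
    from has_derivative_compose[OF this der]
    have "((\<lambda>t. f (x + t *\<^sub>R axis i 1)) has_derivative (\<lambda>h. g (x + t *\<^sub>R axis i 1) \<bullet> (h *\<^sub>R axis i 1))) (at t)" .
    moreover have "t *\<^sub>R axis i 1 = axis i t" for t :: real
      by (simp add: axis_def vec_eq_iff)
    ultimately show ?thesis
      by (simp add: has_field_derivative_def inner_axis mult_commute_abs)
  qed
  have axis0: "axis i 0 = (0 :: real ^ 'n)" by (simp add: axis_eq_0_iff)
  have qB: "norm (q n x) \<le> B" for n x
  proof -
    obtain z where "f (x + axis i (s n)) - f (x + axis i 0) = (s n - 0) * (g (x + axis i z) $ i)"
      using MVT2[of 0 "s n" "\<lambda>t. f (x + axis i t)" "\<lambda>t. g (x + axis i t) $ i"] line s(1)[of n] by blast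
    then have "q n x = g (x + axis i z) $ i"
      using s(1)[of n] by (simp add: q_def field_simps axis0)
    then show ?thesis using B by simp
  qed
  have q_lim: "(\<lambda>n. q n x) \<longlonglongrightarrow> g x $ i" for x
  proof -
    have "((\<lambda>h. (f (x + axis i (0 + h)) - f (x + axis i 0)) / h) \<longlongrightarrow> g x $ i) (at 0)"
      using line[of x 0] by (simp add: DERIV_def axis0)
    from filterlim_compose[OF this s_at] show ?thesis by (simp add: q_def axis0)
  qed
  have p: "lattice_periodic (\<lambda>x. complex_of_real (f (x + v)))" "continuous_on UNIV (\<lambda>x. complex_of_real (f (x + v)))" for v
    using f fc by (auto intro!: lattice_periodic_comp[where f = of_real] lattice_periodic_shift
        continuous_intros continuous_on_compose2[OF fc])
  have character_shift: "character (- k) x = character k v * character (- k) (x + v)" for v x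
    using character_add_freq[of k "- k" v] by (simp add: character_add_point mult_ac)
  have "(\<integral>x. of_real (q n x) * character (- k) x \<partial>cell)
      = (character k (axis i (s n)) - 1) / of_real (s n) * c" for n
  proof -
    have "(\<integral>x. of_real (f (x + axis i (s n))) * character (- k) x \<partial>cell)
      = (\<integral>x. character k (axis i (s n)) * (of_real (f (x + axis i (s n))) * character (- k) (x + axis i (s n))) \<partial>cell)"
      by (intro Bochner_Integration.integral_cong)
         (auto simp: mult_ac intro: character_shift)
    also have "\<dots> = character k (axis i (s n)) * (\<integral>x. of_real (f (x + axis i (s n))) * character (- k) (x + axis i (s n)) \<partial>cell)"
      by simp
    also have "(\<integral>x. of_real (f (x + axis i (s n))) * character (- k) (x + axis i (s n)) \<partial>cell) = c"
      unfolding c_def fourier_coeff_def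
      by (rule integral_cell_translate[of "\<lambda>x. of_real (f x) * character (- k) x"])
         (use p[of 0] s[of n] in \<open>auto intro!: periodic_continuous_times_character less_imp_le continuous_intros\<close>)
    finally have 1: "(\<integral>x. of_real (f (x + axis i (s n))) * character (- k) x \<partial>cell) = character k (axis i (s n)) * c" .
    have "(\<integral>x. of_real (q n x) * character (- k) x \<partial>cell)
       = (\<integral>x. (of_real (f (x + axis i (s n))) * character (- k) x - of_real (f (x + 0)) * character (- k) x) / of_real (s n) \<partial>cell)"
      by (intro Bochner_Integration.integral_cong) (simp_all add: q_def left_diff_distrib diff_divide_distrib)
    also have "\<dots> = (character k (axis i (s n)) * c - c) / of_real (s n)"
      using 1 by (simp only: Bochner_Integration.integral_divide_zero)
        (subst Bochner_Integration.integral_diff,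
         auto simp: c_def fourier_coeff_def intro!: integrable_cell periodic_continuous_times_character p p[of 0, simplified])
    finally show ?thesis by (simp add: algebra_simps)
  qed
  moreover have "(\<lambda>n. \<integral>x. of_real (q n x) * character (- k) x \<partial>cell)
      \<longlonglongrightarrow> (\<integral>x. of_real (g x $ i) * character (- k) x \<partial>cell)"
  proof (rule integral_dominated_convergence[where w = "\<lambda>x. B"])
    show "AE x in cell. (\<lambda>n. of_real (q n x) * character (- k) x) \<longlonglongrightarrow> of_real (g x $ i) * character (- k) x"
      by (intro AE_I2 tendsto_intros q_lim)
    show "AE x in cell. norm (of_real (q n x) * character (- k) x) \<le> B" for n
      using qB by (intro AE_I2) (simp add: norm_mult)
    show "(\<lambda>x. of_real (g x $ i) * character (- k) x) \<in> borel_measurable cell"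
      by (intro borel_measurable_cell continuous_intros cont)
    show "(\<lambda>x. of_real (q n x) * character (- k) x) \<in> borel_measurable cell" for n
      unfolding q_def using s(1)[of n]
      by (intro borel_measurable_cell continuous_intros continuous_on_compose2[OF fc]) auto
  qed auto
  moreover have "(\<lambda>n. (character k (axis i (s n)) - 1) / of_real (s n) * c) \<longlonglongrightarrow> (2 * pi * \<i> * of_int (k $ i)) * c"
  proof -
    have "((\<lambda>z. exp (2 * pi * \<i> * of_int (k $ i) * z)) has_field_derivative (2 * pi * \<i> * of_int (k $ i))) (at 0)"
      by (auto intro!: derivative_eq_intros)
    then have "((\<lambda>z. (exp (2 * pi * \<i> * of_int (k $ i) * z) - 1) / z) \<longlongrightarrow> 2 * pi * \<i> * of_int (k $ i)) (at 0)"
      by (simp add: DERIV_def)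
    moreover have "filterlim (\<lambda>n. complex_of_real (s n)) (at 0) sequentially"
      using s(1) tendsto_of_real[OF s0, where 'a=complex]
      by (auto simp: filterlim_at intro!: always_eventually less_imp_neq[symmetric])
    ultimately have "(\<lambda>n. (exp (2 * pi * \<i> * of_int (k $ i) * of_real (s n)) - 1) / of_real (s n)) \<longlonglongrightarrow> 2 * pi * \<i> * of_int (k $ i)"
      by (rule filterlim_compose)
    moreover have "character k (axis i (s n)) = exp (2 * pi * \<i> * of_int (k $ i) * of_real (s n))" for n
      by (simp add: character_def cis_conv_exp inner_axis mult_ac)
    ultimately show ?thesis by (intro tendsto_intros) simp
  qed
  ultimately show ?thesis
    unfolding c_def fourier_coeff_def by (auto dest: LIMSEQ_unique)
qed

lemma fourier_coeff_Ck_decay: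
  fixes f :: "real ^ ('n::finite) \<Rightarrow> real"
  assumes "lattice_periodic f" "Ck N f"
  shows "\<exists>B. \<forall>k. \<bar>real_of_int (k $ i)\<bar> ^ N * norm (fourier_coeff (\<lambda>x. of_real (f x)) k) \<le> B"
  using assms
proof (induction N arbitrary: f)
  case 0
  obtain B where "\<And>x. norm (f x) \<le> B"
    using periodic_bounded[of f] 0 by (metis Ck_imp_continuous)
  then have "norm (fourier_coeff (\<lambda>x. of_real (f x)) k) \<le> B" for k
    using 0 by (intro norm_fourier_coeff_le) (auto intro!: lattice_periodic_comp[where f = of_real] continuous_intros)
  then show ?case by auto
next
  case (Suc N)
  then obtain g where g: "\<And>x. (f has_derivative (\<lambda>h. g x \<bullet> h)) (at x)" "\<And>i. Ck N (\<lambda>x. g x $ i)"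
    by auto
  have "lattice_periodic (\<lambda>x. g x $ i)"
    using lattice_periodic_gradient[OF Suc.prems(1) g(1)] by (rule lattice_periodic_comp)
  from Suc.IH[OF this g(2)] obtain B
    where B: "\<And>k. \<bar>real_of_int (k $ i)\<bar> ^ N * norm (fourier_coeff (\<lambda>x. of_real (g x $ i)) k) \<le> B"
    by blast
  have "\<bar>real_of_int (k $ i)\<bar> ^ Suc N * norm (fourier_coeff (\<lambda>x. of_real (f x)) k) \<le> B / (2 * pi)" for k
    using B[of k] fourier_coeff_partial_derivative[OF Suc.prems(1) g(1) Ck_imp_continuous[OF g(2)], of i k]
    by (simp add: norm_mult field_simps)
  then show ?case by blast
qed

section \<open>Fourier inversion\<close>

text \<open>A continuous periodic function with vanishing Fourier coefficients is zero.  The classical proof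
approximates it uniformly by trigonometric polynomials, to which it is orthogonal.  Instead of
describing trigonometric polynomials, one may apply the Stone--Weierstrass theorem to the real
functions that map the space \<open>fourier_null\<close> into itself by multiplication: these
form an algebra for purely formal reasons, and the algebra separates points because multiplication
by a character only permutes the Fourier coefficients.\<close>

definition fourier_null :: "(real ^ ('n::finite) \<Rightarrow> complex) set" where
  "fourier_null = {h. lattice_periodic h \<and> continuous_on UNIV h \<and>
     (\<forall>k. (\<integral>x. h x * character k x \<partial>cell) = 0)}"

lemma fourier_null_add:
  assumes "f \<in> fourier_null" "g \<in> fourier_null"
  shows "(\<lambda>x. f x + g x) \<in> fourier_null"
proof -
  have "(\<integral>x. (f x + g x) * character k x \<partial>cell)
      = (\<integral>x. f x * character k x \<partial>cell) + (\<integral>x. g x * character k x \<partial>cell)" for k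
    unfolding distrib_right using assms
    by (intro Bochner_Integration.integral_add integrable_cell periodic_continuous_times_character)
       (auto simp: fourier_null_def)
  with assms show ?thesis
    by (auto simp: fourier_null_def intro!: lattice_periodic_comp2[where f = "(+)"] continuous_intros)
qed

lemma fourier_null_scale:
  assumes "f \<in> fourier_null"
  shows "(\<lambda>x. c * f x) \<in> fourier_null"
  using assms by (auto simp: fourier_null_def mult.assoc intro!: lattice_periodic_comp[where f = "(*) c"] continuous_intros)

lemma fourier_null_times_character:
  assumes "f \<in> fourier_null"
  shows "(\<lambda>x. f x * character l x) \<in> fourier_null"
  using assms periodic_continuous_times_character[of f l]
  by (auto simp: fourier_null_def mult.assoc character_add_freq[symmetric])

definition null_multipliers :: "(('n::finite) torus \<Rightarrow> real) set" where
  "null_multipliers = {F. continuous_on UNIV F \<and>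
     (\<forall>h\<in>fourier_null. (\<lambda>x. h x * of_real (F (to_torus x))) \<in> fourier_null)}"

lemma null_multipliers_separate:
  fixes z w :: "('n::finite) torus"
  assumes "z \<noteq> w"
  obtains F where "F \<in> null_multipliers" "F z \<noteq> F w"
proof -
  obtain x y where xy: "z = to_torus x" "w = to_torus y" by (metis to_torus_surj)
  then obtain i where i: "x $ i - y $ i \<notin> \<int>" using assms by (auto simp: to_torus_eq_iff)
  define e :: "int ^ 'n" where "e = axis i 1"
  have e: "character e v = cis (2 * pi * (v $ i))" for v
  proof -
    have "freq e = axis i 1" by (simp add: e_def vec_eq_iff axis_def)
    then show ?thesis by (simp add: character_def inner_axis')
  qed
  have em: "character (- e) v = cnj (character e v)" for v
    by (simp add: character_def cis_cnj)
  define C where "C = descend (\<lambda>v. Re (character e v))"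
  define S where "S = descend (\<lambda>v. Im (character e v))"
  have CS: "C (to_torus v) = Re (character e v)" "S (to_torus v) = Im (character e v)" for v
    by (simp_all add: C_def S_def lattice_periodic_comp)
  have "C \<in> null_multipliers"
  proof -
    have "(\<lambda>x. h x * of_real (Re (character e x))) \<in> fourier_null" if h: "h \<in> fourier_null" for h
    proof -
      have eqRe: "(\<lambda>x. h x * of_real (Re (character e x)))
          = (\<lambda>x. (1/2) * (h x * character e x) + (1/2) * (h x * character (- e) x))"
        by (rule ext) (simp add: em complex_eq_iff field_simps)
      show ?thesis
        unfolding eqRe by (intro fourier_null_add fourier_null_scale fourier_null_times_character h)
    qed
    then show ?thesis
      by (auto simp: null_multipliers_def CS intro!: continuous_on_torusI continuous_intros)
  qed
  moreover have "S \<in> null_multipliers"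
  proof -
    have "(\<lambda>x. h x * of_real (Im (character e x))) \<in> fourier_null" if h: "h \<in> fourier_null" for h
    proof -
      have eqIm: "(\<lambda>x. h x * of_real (Im (character e x)))
          = (\<lambda>x. (-\<i>/2) * (h x * character e x) + (\<i>/2) * (h x * character (- e) x))"
        by (rule ext) (simp add: em complex_eq_iff field_simps)
      show ?thesis
        unfolding eqIm by (intro fourier_null_add fourier_null_scale fourier_null_times_character h)
    qed
    then show ?thesis
      by (auto simp: null_multipliers_def CS intro!: continuous_on_torusI continuous_intros)
  qed
  moreover have "C z \<noteq> C w \<or> S z \<noteq> S w"
  proof (rule ccontr)
    assume "\<not> ?thesis"
    then have "cis (2 * pi * (x $ i)) = cis (2 * pi * (y $ i))"
      by (simp add: xy CS e[symmetric] complex_eq_iff)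
    then have "cis (2 * pi * (x $ i)) / cis (2 * pi * (y $ i)) = 1" by simp
    then have "cis (2 * pi * (x $ i - y $ i)) = 1"
      by (simp add: cis_divide right_diff_distrib)
    then have "cos (2 * pi * (x $ i - y $ i)) = 1" by (simp add: complex_eq_iff)
    then obtain n :: int where "2 * pi * (x $ i - y $ i) = of_int n * 2 * pi"
      by (auto simp: cos_one_2pi_int)
    then have "x $ i - y $ i = of_int n" by simp
    with i show False by simp
  qed
  ultimately show thesis using that by blast
qed

lemma function_ring_on_null_multipliers:
  "function_ring_on (null_multipliers :: (('n::finite) torus \<Rightarrow> real) set) UNIV"
proof
  show "compact (UNIV :: 'n torus set)" by (rule compact_torus)
  fix f g :: "'n torus \<Rightarrow> real" assume f: "f \<in> null_multipliers"
  then show "continuous_on UNIV f" by (simp add: null_multipliers_def)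
  assume g: "g \<in> null_multipliers"
  have "(\<lambda>x. h x * of_real (f (to_torus x) + g (to_torus x))) \<in> fourier_null"
    if h: "h \<in> fourier_null" for h
    using f g h unfolding of_real_add distrib_left
    by (intro fourier_null_add) (auto simp: null_multipliers_def)
  with f g show "(\<lambda>x. f x + g x) \<in> null_multipliers"
    by (auto simp: null_multipliers_def intro!: continuous_intros)
  have "(\<lambda>x. h x * of_real (f (to_torus x) * g (to_torus x))) \<in> fourier_null"
    if h: "h \<in> fourier_null" for h
  proof -
    have "(\<lambda>x. h x * of_real (f (to_torus x))) \<in> fourier_null"
      using f h by (simp add: null_multipliers_def)
    then have "(\<lambda>x. h x * of_real (f (to_torus x)) * of_real (g (to_torus x))) \<in> fourier_null"
      using g by (simp add: null_multipliers_def)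
    then show ?thesis by (simp add: mult.assoc)
  qed
  with f g show "(\<lambda>x. f x * g x) \<in> null_multipliers"
    by (auto simp: null_multipliers_def intro!: continuous_intros)
next
  fix c
  show "(\<lambda>_. c) \<in> (null_multipliers :: ('n torus \<Rightarrow> real) set)"
    using fourier_null_scale[of _ "of_real c"] by (auto simp: null_multipliers_def mult.commute)
next
  fix x y :: "'n torus" assume "x \<noteq> y"
  then show "\<exists>f\<in>null_multipliers. f x \<noteq> f y" by (metis null_multipliers_separate)
qed

text \<open>True for multipliers by taking the zeroth coefficient, and multipliers are uniformly dense.\<close>

lemma integral_fourier_null_times_real:
  fixes h :: "real ^ ('n::finite) \<Rightarrow> complex" and a :: "real ^ 'n \<Rightarrow> real"
  assumes h: "h \<in> fourier_null" and a: "lattice_periodic a" "continuous_on UNIV a"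
  shows "(\<integral>x. h x * of_real (a x) \<partial>cell) = 0"
proof -
  have hp: "lattice_periodic h" "continuous_on UNIV h" using h by (auto simp: fourier_null_def)
  obtain B where B: "B > 0" "\<And>x. norm (h x) \<le> B" using periodic_bounded[OF hp] by metis
  have "norm (\<integral>x. h x * of_real (a x) \<partial>cell) \<le> 0 + e" if "e > 0" for e
  proof -
    have "continuous_on UNIV (descend a)"
      using a by (intro continuous_on_torusI) simp
    moreover have "e / B > 0" using that B(1) by simp
    ultimately obtain F where F: "F \<in> null_multipliers" "\<And>z. \<bar>descend a z - F z\<bar> < e / B"
      using function_ring_on.Stone_Weierstrass_basic[OF function_ring_on_null_multipliers] by blast
    have Fc: "continuous_on UNIV (\<lambda>x. F (to_torus x))"
      using F(1) continuous_to_torus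
      by (auto simp: null_multipliers_def intro: continuous_on_compose2)
    have close: "\<bar>a x - F (to_torus x)\<bar> \<le> e / B" for x
      using F(2)[of "to_torus x"] a by (simp add: less_imp_le)
    have "(\<lambda>x. h x * of_real (F (to_torus x))) \<in> fourier_null"
      using F(1) h by (simp add: null_multipliers_def)
    then have "(\<integral>x. h x * of_real (F (to_torus x)) * character 0 x \<partial>cell) = 0"
      unfolding fourier_null_def by blast
    then have "(\<integral>x. h x * of_real (a x) \<partial>cell)
        = (\<integral>x. h x * of_real (a x) \<partial>cell) - (\<integral>x. h x * of_real (F (to_torus x)) \<partial>cell)"
      by simp
    also have "\<dots> = (\<integral>x. h x * of_real (a x) - h x * of_real (F (to_torus x)) \<partial>cell)"
      using hp a Fc
      by (intro Bochner_Integration.integral_diff[symmetric] integrable_cell continuous_intros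
          lattice_periodic_comp2[where f = "\<lambda>u v. u * of_real v"] lattice_periodic_to_torus)
    also have "norm \<dots> \<le> B * (e / B)"
    proof (rule norm_integral_cell_le)
      show "lattice_periodic (\<lambda>x. h x * of_real (a x) - h x * of_real (F (to_torus x)))"
        by (intro lattice_periodic_comp2[where f = "(-)"]
          lattice_periodic_comp2[where f = "\<lambda>u v. u * of_real v"] hp a lattice_periodic_to_torus)
      show "continuous_on UNIV (\<lambda>x. h x * of_real (a x) - h x * of_real (F (to_torus x)))"
        by (intro continuous_intros hp a Fc)
      fix x
      have "norm (h x * of_real (a x) - h x * of_real (F (to_torus x)))
          = norm (h x) * \<bar>a x - F (to_torus x)\<bar>"
        by (metis norm_mult norm_of_real of_real_diff right_diff_distrib)
      also have "\<dots> \<le> B * (e / B)"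
        using B close by (intro mult_mono) auto
      finally show "norm (h x * of_real (a x) - h x * of_real (F (to_torus x))) \<le> B * (e / B)" .
    qed
    finally show ?thesis using B(1) by simp
  qed
  then have "norm (\<integral>x. h x * of_real (a x) \<partial>cell) \<le> 0"
    by (rule field_le_epsilon)
  then show ?thesis by simp
qed

text \<open>Orthogonality of \<open>h\<close> to its own real and imaginary parts makes both of them vanish.\<close>

lemma fourier_uniqueness:
  fixes h :: "real ^ ('n::finite) \<Rightarrow> complex"
  assumes hp: "lattice_periodic h" "continuous_on UNIV h" and "\<And>k. fourier_coeff h k = 0"
  shows "h x = 0"
proof -
  have "(\<integral>x. h x * character k x \<partial>cell) = 0" for k
    using assms(3)[of "- k"] by (simp add: fourier_coeff_def)
  then have h: "h \<in> fourier_null" using hp by (simp add: fourier_null_def)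
  have p: "lattice_periodic (\<lambda>x. Re (h x))" "continuous_on UNIV (\<lambda>x. Re (h x))"
    "lattice_periodic (\<lambda>x. Im (h x))" "continuous_on UNIV (\<lambda>x. Im (h x))"
    using hp by (auto intro!: lattice_periodic_comp[where f = Re] lattice_periodic_comp[where f = Im] continuous_intros)
  have int: "integrable cell (\<lambda>x. h x * of_real (a x))"
    if "lattice_periodic a" "continuous_on UNIV a" for a :: "real ^ 'n \<Rightarrow> real"
    using hp that
    by (intro integrable_cell continuous_intros lattice_periodic_comp2[where f = "\<lambda>u v. u * of_real v"])
  have sq: "(a x)\<^sup>2 = 0" if a: "lattice_periodic a" "continuous_on UNIV a" and "(\<integral>x. (a x)\<^sup>2 \<partial>cell) = 0"
    for a :: "real ^ 'n \<Rightarrow> real"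
    by (rule integral_cell_eq_0_imp_eq_0)
       (use that in \<open>auto intro!: lattice_periodic_comp[where f = "\<lambda>u. u\<^sup>2"] continuous_intros\<close>)
  have "(\<integral>x. (Re (h x))\<^sup>2 \<partial>cell) = Re (\<integral>x. h x * of_real (Re (h x)) \<partial>cell)"
    by (subst integral_Re[OF int[OF p(1,2)], symmetric]) (simp add: power2_eq_square)
  moreover have "(\<integral>x. (Im (h x))\<^sup>2 \<partial>cell) = Im (\<integral>x. h x * of_real (Im (h x)) \<partial>cell)"
    by (subst integral_Im[OF int[OF p(3,4)], symmetric]) (simp add: power2_eq_square)
  ultimately show ?thesis
    using sq[OF p(1,2)] sq[OF p(3,4)] integral_fourier_null_times_real[OF h]
    by (simp add: p complex_eq_iff)
qed

lemma fourier_coeff_character_sum: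
  assumes "finite F"
  shows "fourier_coeff (\<lambda>x. \<Sum>k\<in>F. a k * character k x) j = (if j \<in> F then a j else 0)"
proof -
  have "fourier_coeff (\<lambda>x. \<Sum>k\<in>F. a k * character k x) j
      = (\<integral>x. (\<Sum>k\<in>F. a k * character (k - j) x) \<partial>cell)"
    unfolding fourier_coeff_def
    by (intro Bochner_Integration.integral_cong)
       (auto simp: sum_distrib_right mult.assoc character_add_freq[symmetric])
  also have "\<dots> = (\<Sum>k\<in>F. a k * integral\<^sup>L cell (character (k - j)))"
    by (subst Bochner_Integration.integral_sum)
       (auto intro!: integrable_mult_right integrable_cell continuous_on_character)
  also have "\<dots> = (\<Sum>k\<in>F. if k = j then a k else 0)"
    by (intro sum.cong) (auto simp: integral_character)
  finally show ?thesis using assms by simp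
qed

text \<open>An absolutely convergent Fourier series converges to a continuous function with the same
  coefficients, hence to the function one started with.\<close>

lemma fourier_inversion:
  fixes f :: "real ^ ('n::finite) \<Rightarrow> complex"
  assumes f: "lattice_periodic f" "continuous_on UNIV f"
    and sm: "(\<lambda>k. norm (fourier_coeff f k)) summable_on UNIV"
  shows "uniform_limit UNIV (\<lambda>F x. \<Sum>k\<in>F. fourier_coeff f k * character k x) f (finite_subsets_at_top UNIV)"
proof -
  define P where "P F x = (\<Sum>k\<in>F. fourier_coeff f k * character k x)" for F x
  define S where "S x = (\<Sum>\<^sub>\<infinity>k. fourier_coeff f k * character k x)" for x
  have lim: "uniform_limit UNIV P S (finite_subsets_at_top UNIV)"
    unfolding P_def[abs_def] S_def[abs_def]
    by (rule Weierstrass_m_test_general[OF _ sm]) (simp add: norm_mult)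
  have Pp: "lattice_periodic (P F)" "continuous_on UNIV (P F)" for F
    unfolding P_def[abs_def]
    by (auto simp: lattice_periodic_def intro!: continuous_intros sum.cong lattice_periodicD[OF lattice_periodic_character])
  have Sc: "continuous_on UNIV S"
    by (rule uniform_limit_theorem[OF _ lim]) (auto intro: Pp)
  have Sp: "lattice_periodic S"
    unfolding S_def[abs_def] lattice_periodic_def
    by (auto intro!: infsum_cong lattice_periodicD[OF lattice_periodic_character])
  have "fourier_coeff S j = fourier_coeff f j" for j
  proof -
    have "norm (fourier_coeff S j - fourier_coeff f j) \<le> 0 + e" if "e > 0" for e
    proof -
      have "\<forall>\<^sub>F F in finite_subsets_at_top UNIV. finite F \<and> {j} \<subseteq> F \<and> (\<forall>x\<in>UNIV. dist (P F x) (S x) < e)"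
        by (intro eventually_conj uniform_limitD[OF lim that] eventually_finite_subsets_at_top_finite
            eventually_finite_subsets_at_top_weakI eventually_finite_subsets_at_top[THEN iffD2])
           auto
      then obtain F where F: "finite F" "j \<in> F" "\<And>x. dist (P F x) (S x) < e"
        by (auto dest!: eventually_happens simp: finite_subsets_at_top_neq_bot)
      have "fourier_coeff S j - fourier_coeff f j = fourier_coeff (\<lambda>x. S x - P F x) j"
        using F(1,2) by (subst fourier_coeff_diff[OF Sp Sc Pp]) (simp add: P_def[abs_def] fourier_coeff_character_sum)
      also have "norm \<dots> \<le> e"
        using F(3) by (intro norm_fourier_coeff_le lattice_periodic_comp2[where f = "(-)"] continuous_intros Sp Sc Pp)
          (auto simp: dist_norm norm_minus_commute intro: less_imp_le)
      finally show ?thesis by simp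
    qed
    then have "norm (fourier_coeff S j - fourier_coeff f j) \<le> 0" by (rule field_le_epsilon)
    then show ?thesis by simp
  qed
  then have "S x - f x = 0" for x
    by (intro fourier_uniqueness[of "\<lambda>x. S x - f x"])
       (auto simp: fourier_coeff_diff Sp Sc f intro!: lattice_periodic_comp2[where f = "(-)"] continuous_intros)
  then have "S = f" by auto
  with lim show ?thesis by (simp add: P_def[abs_def])
qed

section \<open>Decay of Fourier coefficients and summability\<close>

text \<open>The \<open>\<ell>\<^sup>1\<close> norm of the frequency vector.  Its value is a natural number because
observation times will be computed from it.\<close>

definition height :: "int ^ 'n \<Rightarrow> nat" where
  "height k = (\<Sum>i\<in>UNIV. nat \<bar>k $ i\<bar>)"

lemma real_height: "real (height k) = (\<Sum>i\<in>UNIV. \<bar>real_of_int (k $ i)\<bar>)"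
  by (simp add: height_def)

lemma height_pos: "k \<noteq> 0 \<Longrightarrow> 0 < height (k :: int ^ 'n)"
  unfolding height_def by (auto simp: vec_eq_iff intro!: sum_pos2)

lemma norm_freq_le_height: "norm (freq k) \<le> real (height k)"
  unfolding real_height using norm_le_l1_cart[of "freq k"] by simp

text \<open>Differentiating \<open>N\<close> times in the direction of the largest coordinate of \<open>k\<close>
gains the \<open>N\<close>-th power of that coordinate, which is comparable to the height.\<close>

lemma fourier_coeff_height_decay:
  fixes f :: "real ^ ('n::finite) \<Rightarrow> real"
  assumes "lattice_periodic f" "Ck N f"
  obtains B where "B > 0"
    "\<And>k. real (height k) ^ N * norm (fourier_coeff (\<lambda>x. of_real (f x)) k) \<le> B"
proof -
  let ?c = "\<lambda>k. norm (fourier_coeff (\<lambda>x. complex_of_real (f x)) k)"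
  obtain b where b: "\<And>i k. \<bar>real_of_int (k $ i)\<bar> ^ N * ?c k \<le> b i"
    using fourier_coeff_Ck_decay[OF assms] by metis
  define B where "B = real CARD('n) ^ N * (\<Sum>i\<in>UNIV. \<bar>b i\<bar>) + 1"
  have "real (height k) ^ N * ?c k \<le> B" for k
  proof -
    define m where "m = (MAX i. \<bar>real_of_int (k $ i)\<bar>)"
    have "m \<in> range (\<lambda>i. \<bar>real_of_int (k $ i)\<bar>)" unfolding m_def by (rule Max_in) auto
    then obtain i where i: "m = \<bar>real_of_int (k $ i)\<bar>" by auto
    have "real (height k) \<le> (\<Sum>j\<in>(UNIV::'n set). m)"
      unfolding real_height m_def by (intro sum_mono Max_ge) auto
    then have "real (height k) ^ N \<le> (real CARD('n) * m) ^ N"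
      by (intro power_mono) auto
    then have "real (height k) ^ N * ?c k \<le> (real CARD('n) * m) ^ N * ?c k"
      by (intro mult_right_mono) auto
    also have "\<dots> = real CARD('n) ^ N * (m ^ N * ?c k)" by (simp add: power_mult_distrib)
    also have "\<dots> \<le> real CARD('n) ^ N * \<bar>b i\<bar>"
      using b[where i = i and k = k] by (intro mult_left_mono) (auto simp: i intro: order_trans[OF _ abs_ge_self])
    also have "\<dots> \<le> real CARD('n) ^ N * (\<Sum>i\<in>UNIV. \<bar>b i\<bar>)"
      by (intro mult_left_mono member_le_sum) auto
    finally show ?thesis by (simp add: B_def)
  qed
  moreover have "B > 0"
    unfolding B_def by (intro add_nonneg_pos mult_nonneg_nonneg sum_nonneg) auto
  ultimately show thesis using that by blast
qed

lemma sum_inverse_squares_int_bounded: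
  obtains C :: real where "C \<ge> 0" "\<And>T :: int set. finite T \<Longrightarrow> (\<Sum>t\<in>T. 2 / (1 + (of_int t)\<^sup>2)) \<le> C"
proof -
  define g :: "nat \<Rightarrow> real" where "g m = 2 / (1 + (real m)\<^sup>2)" for m
  have g0: "g m \<ge> 0" for m by (simp add: g_def add_nonneg_nonneg)
  have "summable g"
  proof (rule summable_comparison_test')
    show "summable (\<lambda>m. 2 * inverse (real m ^ 2))"
      by (intro summable_mult inverse_power_summable) auto
    show "norm (g m) \<le> 2 * inverse (real m ^ 2)" if "m \<ge> 1" for m
    proof -
      have "0 < real m" using that by simp
      then show ?thesis by (simp add: g_def field_simps add_pos_pos)
    qed
  qed
  have half: "(\<Sum>t\<in>T. g (nat \<bar>t\<bar>)) \<le> suminf g" if "finite T" "inj_on (\<lambda>t. nat \<bar>t\<bar>) T" for T :: "int set"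
  proof -
    have "(\<Sum>t\<in>T. g (nat \<bar>t\<bar>)) = (\<Sum>m\<in>(\<lambda>t. nat \<bar>t\<bar>) ` T. g m)"
      using that by (simp add: sum.reindex)
    also have "\<dots> \<le> suminf g"
      using that g0 by (intro sum_le_suminf \<open>summable g\<close>) auto
    finally show ?thesis .
  qed
  have "(\<Sum>t\<in>T. 2 / (1 + (of_int t)\<^sup>2)) \<le> 2 * suminf g" if T: "finite T" for T :: "int set"
  proof -
    have "(\<Sum>t\<in>T. 2 / (1 + (of_int t)\<^sup>2)) = (\<Sum>t\<in>T. g (nat \<bar>t\<bar>))"
      by (intro sum.cong) (auto simp: g_def)
    also have "\<dots> = (\<Sum>t\<in>T \<inter> {0..}. g (nat \<bar>t\<bar>)) + (\<Sum>t\<in>T - {0..}. g (nat \<bar>t\<bar>))"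
      using T by (rule sum.Int_Diff)
    also have "\<dots> \<le> suminf g + suminf g"
      using T by (intro add_mono half) (auto simp: inj_on_def)
    finally show ?thesis by simp
  qed
  moreover have "2 * suminf g \<ge> 0" using suminf_nonneg[OF \<open>summable g\<close> g0] by simp
  ultimately show thesis using that by blast
qed

text \<open>For nonzero \<open>k\<close>, the power \<open>2 n\<close> of the height dominates the product of the
  \<open>(1 + k\<^sub>i\<^sup>2) / 2\<close>, where \<open>n\<close> is the dimension, and a sum of products over a box is a product of one-dimensional sums.\<close>

lemma summable_inverse_height:
  "(\<lambda>k :: int ^ ('n::finite). 1 / real (height k) ^ (2 * CARD('n))) summable_on (- {0})"
proof -
  obtain C :: real where C: "C \<ge> 0" "\<And>T :: int set. finite T \<Longrightarrow> (\<Sum>t\<in>T. 2 / (1 + (of_int t)\<^sup>2)) \<le> C"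
    using sum_inverse_squares_int_bounded by blast
  define w :: "int \<Rightarrow> real" where "w t = 2 / (1 + (of_int t)\<^sup>2)" for t
  have w0: "w t \<ge> 0" for t by (simp add: w_def add_nonneg_nonneg)
  have le: "1 / real (height k) ^ (2 * CARD('n)) \<le> (\<Prod>i\<in>UNIV. w (k $ i))" if "k \<noteq> 0" for k :: "int ^ 'n"
  proof -
    have h1: "1 \<le> real (height k)" using height_pos[OF that] by simp
    have "1 / real (height k) ^ (2 * CARD('n)) = (\<Prod>i\<in>(UNIV::'n set). 1 / (real (height k))\<^sup>2)"
      by (simp add: power_mult power_one_over)
    also have "\<dots> \<le> (\<Prod>i\<in>UNIV. w (k $ i))"
    proof (rule prod_mono)
      fix i
      have "\<bar>real_of_int (k $ i)\<bar> \<le> real (height k)"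
        unfolding real_height by (rule member_le_sum) auto
      then have "(real_of_int (k $ i))\<^sup>2 \<le> (real (height k))\<^sup>2"
        by (simp add: abs_le_square_iff[symmetric])
      moreover have "1 \<le> (real (height k))\<^sup>2" using h1 by simp
      ultimately have "1 + (real_of_int (k $ i))\<^sup>2 \<le> 2 * (real (height k))\<^sup>2" by linarith
      then show "0 \<le> 1 / (real (height k))\<^sup>2 \<and> 1 / (real (height k))\<^sup>2 \<le> w (k $ i)"
        using h1 by (simp add: w_def divide_simps add_pos_nonneg)
    qed
    finally show ?thesis .
  qed
  show ?thesis
  proof (rule nonneg_bounded_partial_sums_imp_summable_on)
    show "\<forall>\<^sub>F F in finite_subsets_at_top (- {0 :: int ^ 'n}).
        (\<Sum>k\<in>F. 1 / real (height k) ^ (2 * CARD('n))) \<le> C ^ CARD('n)"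
    proof (rule eventually_finite_subsets_at_top_weakI)
      fix F :: "(int ^ 'n) set" assume F: "finite F" "F \<subseteq> - {0}"
      define T where "T = (\<Union>k\<in>F. range (\<lambda>i. k $ i))"
      have T: "finite T" unfolding T_def using F by auto
      have "(\<Sum>k\<in>F. 1 / real (height k) ^ (2 * CARD('n))) \<le> (\<Sum>k\<in>F. \<Prod>i\<in>UNIV. w (k $ i))"
        using F by (intro sum_mono le) auto
      also have "\<dots> = (\<Sum>g\<in>(\<lambda>k i. k $ i) ` F. \<Prod>i\<in>UNIV. w (g i))"
        by (subst sum.reindex) (auto simp: inj_on_def vec_eq_iff fun_eq_iff)
      also have "\<dots> \<le> (\<Sum>g\<in>PiE (UNIV :: 'n set) (\<lambda>_. T). \<Prod>i\<in>UNIV. w (g i))"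
        using T w0 by (intro sum_mono2 finite_PiE prod_nonneg) (auto simp: T_def)
      also have "\<dots> = (\<Prod>i\<in>(UNIV::'n set). \<Sum>t\<in>T. w t)"
        using T by (intro prod_sum_PiE[symmetric]) auto
      also have "\<dots> = (\<Sum>t\<in>T. w t) ^ CARD('n)" by simp
      also have "\<dots> \<le> C ^ CARD('n)"
        using C(2)[OF T] w0 by (intro power_mono sum_nonneg) (auto simp: w_def)
      finally show "(\<Sum>k\<in>F. 1 / real (height k) ^ (2 * CARD('n))) \<le> C ^ CARD('n)" .
    qed
  qed auto
qed

section \<open>The cohomological equation\<close>

lemma has_vector_derivative_cis:
  assumes "(f has_real_derivative f') (at t)"
  shows "((\<lambda>t. cis (f t)) has_vector_derivative f' *\<^sub>R (\<i> * cis (f t))) (at t)"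
proof -
  have "((\<lambda>t. \<i> * complex_of_real (f t)) has_vector_derivative \<i> * complex_of_real f') (at t)"
    using assms by (intro has_vector_derivative_mult_right has_vector_derivative_of_real)
      (simp add: has_real_derivative_iff_has_vector_derivative)
  from field_vector_diff_chain_at[OF this DERIV_exp] show ?thesis
    by (simp add: o_def cis_conv_exp scaleR_conv_of_real mult_ac)
qed

lemma cis_lipschitz: "norm (cis a - cis b) \<le> \<bar>a - b\<bar>"
proof -
  have "norm (cis a - cis b) \<le> 1 * norm (a - b)"
  proof (rule differentiable_bound[OF convex_UNIV])
    show "(cis has_derivative (\<lambda>h. h *\<^sub>R (\<i> * cis t))) (at t within UNIV)" for t
      using has_vector_derivative_cis[of "\<lambda>t. t" 1 t] by (simp add: has_vector_derivative_def)
    show "onorm (\<lambda>h. h *\<^sub>R (\<i> * cis t)) \<le> 1" for t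
      by (rule onorm_le) (simp add: norm_mult)
  qed auto
  then show ?thesis by simp
qed

lemma character_lipschitz:
  "norm (character k x - character k y) \<le> 2 * pi * real (height k) * norm (x - y)"
proof -
  have "norm (character k x - character k y) \<le> \<bar>2 * pi * (freq k \<bullet> x) - 2 * pi * (freq k \<bullet> y)\<bar>"
    unfolding character_def by (rule cis_lipschitz)
  also have "\<dots> = 2 * pi * \<bar>freq k \<bullet> (x - y)\<bar>"
    by (simp add: inner_diff_right abs_mult right_diff_distrib[symmetric])
  also have "\<bar>freq k \<bullet> (x - y)\<bar> \<le> norm (freq k) * norm (x - y)" by (rule Cauchy_Schwarz_ineq2)
  also have "\<dots> \<le> real (height k) * norm (x - y)"
    by (intro mult_right_mono norm_freq_le_height) auto
  finally show ?thesis by (simp add: mult_ac)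
qed

text \<open>Along the vector field \<open>\<alpha>\<close>, differentiation multiplies the Fourier coefficient at
\<open>k\<close> by \<open>2 \<pi> \<i> (freq k \<bullet> \<alpha>)\<close>.  Dividing the coefficients
of \<open>\<psi>\<close> by these numbers gives a formal solution of
\<open>\<partial>\<^sub>\<alpha> u = \<psi> - \<integral> \<psi>\<close>; since smoothness makes the
coefficients of \<open>\<psi>\<close> decay faster than any power, the polynomial lower bound on the
divisors leaves enough decay for \<open>u\<close> to be Lipschitz.

The equation is stated in integrated form along curves tangent to \<open>\<alpha>\<close>, because this
form passes to the limit from the partial sums of the series, and \<open>u\<close> itself need not be
differentiated.\<close>

lemma cohomological_equation:
  fixes \<psi> :: "real ^ ('n::finite) \<Rightarrow> real" and \<alpha> :: "real ^ 'n"
  assumes \<psi>: "lattice_periodic \<psi>" "\<And>N. Ck N \<psi>"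
    and c: "c > 0" and dio: "\<And>k. k \<noteq> 0 \<Longrightarrow> c / real (height k) ^ \<tau> \<le> \<bar>freq k \<bullet> \<alpha>\<bar>"
  obtains u L where "lattice_periodic u" "L-lipschitz_on UNIV u"
    "\<And>x v E. \<lbrakk>\<And>t. (x has_vector_derivative v t *\<^sub>R \<alpha>) (at t);
        \<And>t. (E has_real_derivative v t * (\<psi> (x t) - integral\<^sup>L cell \<psi>)) (at t);
        \<And>t. \<bar>v t\<bar> \<le> M\<rbrakk>
      \<Longrightarrow> u (x 1) - u (x 0) = E (1 :: real) - E 0"
proof -
  define n where "n = 2 * CARD('n)"
  define a where "a = fourier_coeff (\<lambda>x. complex_of_real (\<psi> x))"
  define d where "d k = a k / (2 * pi * \<i> * (freq k \<bullet> \<alpha>))" for k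
  define Q where "Q k = 1 / real (height k) ^ n" for k :: "int ^ 'n"
  have Q: "Q summable_on (- {0})"
    unfolding Q_def n_def by (rule summable_inverse_height)
  obtain B where B: "B > 0" "\<And>k. real (height k) ^ (n + 1 + \<tau>) * norm (a k) \<le> B"
    using fourier_coeff_height_decay[OF \<psi>] unfolding a_def by metis
  have psic: "continuous_on UNIV \<psi>" by (rule Ck_imp_continuous[OF \<psi>(2)])
  have freq0: "freq k \<bullet> \<alpha> \<noteq> 0" if "k \<noteq> 0" for k
  proof -
    have "0 < c / real (height k) ^ \<tau>" using c height_pos[OF that] by simp
    then show ?thesis using dio[OF that] by auto
  qed
  have a_le: "norm (a k) \<le> B * Q k" if "k \<noteq> 0" for k
  proof -
    have h: "1 \<le> real (height k)" using height_pos[OF that] by simp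
    then have "real (height k) ^ n \<le> real (height k) ^ (n + 1 + \<tau>)"
      by (intro power_increasing) auto
    then have "real (height k) ^ n * norm (a k) \<le> B"
      using B(2)[of k] mult_right_mono[of _ _ "norm (a k)"] by (meson norm_ge_zero order_trans)
    then show ?thesis using h by (simp add: Q_def field_simps)
  qed
  \<comment> \<open>the power \<open>\<tau>\<close> of the height is spent on the small divisor, one more on differentiation\<close>
  have d_le: "real (height k) * norm (d k) \<le> B / c * Q k" if "k \<noteq> 0" for k
  proof -
    define H where "H = real (height k)"
    have h: "1 \<le> H" using height_pos[OF that] by (simp add: H_def)
    have "c / H ^ \<tau> \<le> \<bar>freq k \<bullet> \<alpha>\<bar>" using dio[OF that] by (simp add: H_def)
    moreover have "0 < c / H ^ \<tau>" using c h by simp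
    ultimately have "norm (a k) / \<bar>freq k \<bullet> \<alpha>\<bar> \<le> norm (a k) / (c / H ^ \<tau>)"
      using freq0[OF that] c h by (intro divide_left_mono mult_pos_pos divide_pos_pos) auto
    also have "\<dots> = norm (a k) * H ^ \<tau> / c" by simp
    finally have 1: "H * (norm (a k) / \<bar>freq k \<bullet> \<alpha>\<bar>) \<le> H * (norm (a k) * H ^ \<tau> / c)"
      using h by (intro mult_left_mono) auto
    have "norm (d k) = norm (a k) / \<bar>freq k \<bullet> \<alpha>\<bar> / (2 * pi)"
      by (simp add: d_def norm_divide norm_mult)
    also have "\<dots> \<le> norm (a k) / \<bar>freq k \<bullet> \<alpha>\<bar> / 1"
      using pi_ge_two by (intro divide_left_mono) auto
    finally have "H * norm (d k) \<le> H * (norm (a k) / \<bar>freq k \<bullet> \<alpha>\<bar>)"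
      using h by (intro mult_left_mono) auto
    also note 1
    also have "H * (norm (a k) * H ^ \<tau> / c) = (H ^ (n + 1 + \<tau>) * norm (a k)) / (c * H ^ n)"
      using h c by (simp add: power_add field_simps)
    also have "\<dots> \<le> B / (c * H ^ n)"
      using B(2)[of k] h c by (intro divide_right_mono) (auto simp: H_def)
    finally show ?thesis by (simp add: H_def Q_def)
  qed
  have sum_Q: "(\<Sum>k\<in>F. Q k) \<le> infsum Q (- {0})" if "finite F" "F \<subseteq> - {0}" for F
    using that by (intro finite_sum_le_infsum Q) (auto simp: Q_def)
  define U where "U F x = (\<Sum>k\<in>F. d k * character k x)" for F x
  define u where "u x = Re (\<Sum>\<^sub>\<infinity>k\<in>-{0}. d k * character k x)" for x
  have d_sum: "(\<lambda>k. norm (d k)) summable_on (- {0})"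
  proof (rule summable_on_comparison_test[OF summable_on_cmult_right[OF Q, of "B / c"]])
    fix k :: "int ^ 'n" assume k: "k \<in> - {0}"
    have "1 * norm (d k) \<le> real (height k) * norm (d k)"
      using height_pos[of k] k by (intro mult_right_mono) auto
    also have "\<dots> \<le> B / c * Q k" using d_le k by auto
    finally show "norm (d k) \<le> B / c * Q k" by simp
  qed auto
  have U_lim: "((\<lambda>F. Re (U F x)) \<longlongrightarrow> u x) (finite_subsets_at_top (- {0}))" for x
  proof -
    have "uniform_limit UNIV U (\<lambda>x. \<Sum>\<^sub>\<infinity>k\<in>-{0}. d k * character k x) (finite_subsets_at_top (- {0}))"
      unfolding U_def[abs_def] by (rule Weierstrass_m_test_general[OF _ d_sum]) (simp add: norm_mult)
    then have "((\<lambda>F. U F x) \<longlongrightarrow> (\<Sum>\<^sub>\<infinity>k\<in>-{0}. d k * character k x)) (finite_subsets_at_top (- {0}))"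
      by (rule tendsto_uniform_limitI) simp
    then show ?thesis unfolding u_def by (rule tendsto_Re)
  qed
  have up: "lattice_periodic u"
    unfolding u_def[abs_def] lattice_periodic_def
    by (auto intro!: arg_cong[where f = Re] infsum_cong lattice_periodicD[OF lattice_periodic_character])
  define L where "L = 2 * pi * (B / c * infsum Q (- {0}))"
  have L0: "L \<ge> 0"
    unfolding L_def using B(1) c by (intro mult_nonneg_nonneg infsum_nonneg) (auto simp: Q_def)
  have U_lip: "norm (U F x - U F y) \<le> L * norm (x - y)" if F: "finite F" "F \<subseteq> - {0}" for F x y
  proof -
    have "norm (U F x - U F y) = norm (\<Sum>k\<in>F. d k * (character k x - character k y))"
      by (simp add: U_def sum_subtractf right_diff_distrib)
    also have "\<dots> \<le> (\<Sum>k\<in>F. norm (d k * (character k x - character k y)))" by (rule norm_sum)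
    also have "\<dots> \<le> (\<Sum>k\<in>F. 2 * pi * (B / c * Q k) * norm (x - y))"
    proof (rule sum_mono)
      fix k assume "k \<in> F"
      then have k: "k \<noteq> 0" using F by auto
      have "norm (d k * (character k x - character k y)) \<le> norm (d k) * (2 * pi * real (height k) * norm (x - y))"
        unfolding norm_mult by (intro mult_left_mono character_lipschitz) auto
      also have "\<dots> = 2 * pi * (real (height k) * norm (d k)) * norm (x - y)" by (simp add: mult_ac)
      also have "\<dots> \<le> 2 * pi * (B / c * Q k) * norm (x - y)"
        by (intro mult_right_mono mult_left_mono d_le k) auto
      finally show "norm (d k * (character k x - character k y)) \<le> 2 * pi * (B / c * Q k) * norm (x - y)" .
    qed
    also have "\<dots> = 2 * pi * (B / c * (\<Sum>k\<in>F. Q k)) * norm (x - y)"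
      by (simp only: sum_distrib_left sum_distrib_right)
    also have "\<dots> \<le> L * norm (x - y)"
      unfolding L_def using B(1) c by (intro mult_right_mono mult_left_mono sum_Q F) auto
    finally show ?thesis .
  qed
  have ulip: "L-lipschitz_on UNIV u"
  proof (rule lipschitz_onI[OF _ L0])
    fix x y :: "real ^ 'n"
    have "((\<lambda>F. \<bar>Re (U F x) - Re (U F y)\<bar>) \<longlongrightarrow> \<bar>u x - u y\<bar>) (finite_subsets_at_top (- {0}))"
      by (intro tendsto_intros U_lim)
    moreover have "\<forall>\<^sub>F F in finite_subsets_at_top (- {0}). \<bar>Re (U F x) - Re (U F y)\<bar> \<le> L * norm (x - y)"
    proof (rule eventually_finite_subsets_at_top_weakI)
      fix F :: "(int ^ 'n) set" assume "finite F" "F \<subseteq> - {0}"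
      then show "\<bar>Re (U F x) - Re (U F y)\<bar> \<le> L * norm (x - y)"
        using U_lip[of F x y] abs_Re_le_cmod[of "U F x - U F y"] by simp
    qed
    ultimately have "\<bar>u x - u y\<bar> \<le> L * norm (x - y)"
      by (rule tendsto_upperbound) (rule finite_subsets_at_top_neq_bot)
    then show "dist (u x) (u y) \<le> L * dist x y" by (simp add: dist_norm)
  qed
  have psi_cont: "lattice_periodic (\<lambda>x. complex_of_real (\<psi> x))" "continuous_on UNIV (\<lambda>x. complex_of_real (\<psi> x))"
    using \<psi>(1) psic by (auto intro!: lattice_periodic_comp[where f = of_real] continuous_intros)
  have a0: "a 0 = of_real (integral\<^sup>L cell \<psi>)"
    by (simp add: a_def fourier_coeff_def)
  have a_sum: "(\<lambda>k. norm (a k)) summable_on UNIV"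
  proof -
    have "(\<lambda>k. norm (a k)) summable_on (- {0})"
      by (rule summable_on_comparison_test[OF summable_on_cmult_right[OF Q, of B]])
         (use a_le in auto)
    then have "(\<lambda>k. norm (a k)) summable_on insert 0 (- {0})"
      by (simp add: summable_on_insert_iff)
    moreover have "insert 0 (- {0}) = (UNIV :: (int ^ 'n) set)" by auto
    ultimately show ?thesis by simp
  qed
  note inv = fourier_inversion[OF psi_cont a_sum[unfolded a_def], folded a_def]
  have main: "u (x 1) - u (x 0) = E (1 :: real) - E 0"
    if x: "\<And>t. (x has_vector_derivative v t *\<^sub>R \<alpha>) (at t)"
      and E: "\<And>t. (E has_real_derivative v t * (\<psi> (x t) - integral\<^sup>L cell \<psi>)) (at t)"
      and M: "\<And>t. \<bar>v t\<bar> \<le> M" for x v E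
  proof -
    have M0: "M \<ge> 0" using M[of 0] abs_ge_zero[of "v 0"] by linarith
    have "\<bar>(u (x 1) - u (x 0)) - (E 1 - E 0)\<bar> \<le> 0 + e" if e: "e > 0" for e
    proof -
      have "e / (M + 1) > 0" using e M0 by simp
      from uniform_limitD[OF inv this] obtain F0 where F0: "finite F0"
        "\<And>F y. finite F \<Longrightarrow> F0 \<subseteq> F \<Longrightarrow> dist (\<Sum>k\<in>F. a k * character k y) (\<psi> y) < e / (M + 1)"
        by (auto simp: eventually_finite_subsets_at_top)
      \<comment> \<open>on a finite set of frequencies the equation holds up to the error with which the partial sum
approximates \<open>\<psi>\<close>\<close>
      have step: "\<bar>(Re (U F (x 1)) - Re (U F (x 0))) - (E 1 - E 0)\<bar> \<le> e"
        if F: "finite F" "F \<subseteq> - {0}" "F0 - {0} \<subseteq> F" for F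
      proof -
        define D where "D t = Re (U F (x t)) - E t" for t
        define D' where "D' t = v t * (Re (\<Sum>k\<in>insert 0 F. a k * character k (x t)) - \<psi> (x t))" for t
        have ch: "((\<lambda>t. character k (x t)) has_vector_derivative
            (2 * pi * \<i> * (v t * (freq k \<bullet> \<alpha>))) * character k (x t)) (at t)" for k t
        proof -
          have "((\<lambda>t. 2 * pi * (freq k \<bullet> x t)) has_real_derivative 2 * pi * (v t * (freq k \<bullet> \<alpha>))) (at t)"
            using x[of t] unfolding has_vector_derivative_def has_field_derivative_def
            by (auto intro!: derivative_eq_intros simp: fun_eq_iff algebra_simps)
          then have "((\<lambda>t. cis (2 * pi * (freq k \<bullet> x t))) has_vector_derivative
              (2 * pi * (v t * (freq k \<bullet> \<alpha>))) *\<^sub>R (\<i> * cis (2 * pi * (freq k \<bullet> x t)))) (at t)"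
            by (intro has_vector_derivative_cis)
          then show ?thesis
            by (simp add: character_def scaleR_conv_of_real mult_ac)
        qed
        have "(D has_real_derivative D' t) (at t)" for t
        proof -
          have "((\<lambda>t. U F (x t)) has_vector_derivative
              (\<Sum>k\<in>F. d k * ((2 * pi * \<i> * (v t * (freq k \<bullet> \<alpha>))) * character k (x t)))) (at t)"
            unfolding U_def by (intro has_vector_derivative_sum has_vector_derivative_mult_right ch)
          also have "(\<Sum>k\<in>F. d k * ((2 * pi * \<i> * (v t * (freq k \<bullet> \<alpha>))) * character k (x t)))
              = (\<Sum>k\<in>F. of_real (v t) * (a k * character k (x t)))"
          proof (rule sum.cong)
            fix k assume "k \<in> F"
            then have "k \<noteq> 0" using F by auto
            then have "freq k \<bullet> \<alpha> \<noteq> 0" by (rule freq0)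
            then show "d k * ((2 * pi * \<i> * (v t * (freq k \<bullet> \<alpha>))) * character k (x t))
                = of_real (v t) * (a k * character k (x t))"
              by (simp add: d_def field_simps)
          qed simp
          also have "\<dots> = of_real (v t) * (\<Sum>k\<in>F. a k * character k (x t))"
            by (simp only: sum_distrib_left)
          finally have "((\<lambda>t. Re (U F (x t))) has_real_derivative Re (of_real (v t) * (\<Sum>k\<in>F. a k * character k (x t)))) (at t)"
            unfolding has_real_derivative_iff_has_vector_derivative
            by (rule bounded_linear.has_vector_derivative[OF bounded_linear_Re])
          from DERIV_diff[OF this E[of t]] show ?thesis
            using F by (auto simp: D_def[abs_def] D'_def a0 algebra_simps)
        qed
        moreover have D'_le: "norm (D' t) \<le> e" for t
        proof -
          have "norm (D' t) = \<bar>v t\<bar> * \<bar>Re ((\<Sum>k\<in>insert 0 F. a k * character k (x t)) - of_real (\<psi> (x t)))\<bar>"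
            by (simp add: D'_def abs_mult)
          also have "\<dots> \<le> M * (e / (M + 1))"
          proof (intro mult_mono M)
            have "dist (\<Sum>k\<in>insert 0 F. a k * character k (x t)) (\<psi> (x t)) < e / (M + 1)"
              using F by (intro F0) auto
            then show "\<bar>Re ((\<Sum>k\<in>insert 0 F. a k * character k (x t)) - of_real (\<psi> (x t)))\<bar> \<le> e / (M + 1)"
              using abs_Re_le_cmod[of "(\<Sum>k\<in>insert 0 F. a k * character k (x t)) - of_real (\<psi> (x t))"]
              unfolding dist_norm by linarith
          qed (use M0 in auto)
          also have "\<dots> \<le> e" using M0 e by (simp add: field_simps)
          finally show ?thesis .
        qed
        ultimately have "norm (D 1 - D 0) \<le> e * norm (1 - 0 :: real)"
          by (intro field_differentiable_bound[OF convex_UNIV, of D D' e]) auto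
        then show ?thesis by (simp add: D_def algebra_simps)
      qed
      have "((\<lambda>F. \<bar>(Re (U F (x 1)) - Re (U F (x 0))) - (E 1 - E 0)\<bar>) \<longlongrightarrow>
          \<bar>(u (x 1) - u (x 0)) - (E 1 - E 0)\<bar>) (finite_subsets_at_top (- {0}))"
        by (intro tendsto_intros U_lim)
      moreover have "\<forall>\<^sub>F F in finite_subsets_at_top (- {0}).
          \<bar>(Re (U F (x 1)) - Re (U F (x 0))) - (E 1 - E 0)\<bar> \<le> e"
        unfolding eventually_finite_subsets_at_top
        using F0(1) step by (intro exI[of _ "F0 - {0}"]) auto
      ultimately have "\<bar>(u (x 1) - u (x 0)) - (E 1 - E 0)\<bar> \<le> e"
        by (rule tendsto_upperbound) (rule finite_subsets_at_top_neq_bot)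
      then show ?thesis by simp
    qed
    then have "\<bar>(u (x 1) - u (x 0)) - (E 1 - E 0)\<bar> \<le> 0" by (rule field_le_epsilon)
    then show ?thesis by simp
  qed
  show thesis by (rule that[OF up ulip main])
qed

section \<open>The time-one map and the invariant measure\<close>

lemma lipschitz_norm_le:
  fixes f :: "('n::finite) torus \<Rightarrow> real"
  assumes "L-lipschitz_on UNIV f" "\<And>x. \<bar>f x\<bar> \<le> B"
  shows "0 \<le> lipschitz_norm f" "lipschitz_norm f \<le> B + L"
proof -
  have bdd: "bdd_above (range (\<lambda>x. \<bar>f x\<bar>))" using assms(2) by (intro bdd_aboveI2[of _ _ B])
  have "0 \<le> \<bar>f undefined\<bar>" by simp
  also have "\<dots> \<le> (SUP x. \<bar>f x\<bar>)" by (intro cSUP_upper bdd) simp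
  finally have 1: "0 \<le> (SUP x. \<bar>f x\<bar>)" .
  have 2: "0 \<le> Inf {L. L-lipschitz_on UNIV f}"
    using assms(1) by (intro cInf_greatest) (auto dest: lipschitz_on_nonneg)
  have 3: "(SUP x. \<bar>f x\<bar>) \<le> B" using assms(2) by (intro cSUP_least) auto
  have 4: "Inf {L. L-lipschitz_on UNIV f} \<le> L"
    using assms(1) by (intro cInf_lower) (auto intro!: bdd_belowI[of _ 0] dest: lipschitz_on_nonneg)
  show "0 \<le> lipschitz_norm f" "lipschitz_norm f \<le> B + L"
    using 1 2 3 4 by (auto simp: lipschitz_norm_def)
qed

locale reparametrized_flow =
  fixes \<alpha> :: "real ^ ('n::finite)" and \<phi> :: "'n torus \<Rightarrow> real"
    and F :: "real \<Rightarrow> 'n torus \<Rightarrow> 'n torus"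
  assumes smooth: "torus_smooth \<phi>" and pos: "0 < \<phi> x"
    and flow: "generates_flow (\<lambda>x. \<phi> x *\<^sub>R \<alpha>) F"
begin

definition slowness :: "real ^ 'n \<Rightarrow> real" where
  "slowness x = 1 / \<phi> (to_torus x)"

definition mean_slowness :: real where
  "mean_slowness = integral\<^sup>L cell slowness"

lemma Ck_speed: "Ck k (\<lambda>x. \<phi> (to_torus x))"
  using smooth by (simp add: torus_smooth_def)

lemma continuous_speed: "continuous_on UNIV \<phi>"
  using Ck_imp_continuous[OF Ck_speed] by (rule continuous_on_torusI)

lemma Ck_slowness: "Ck k slowness"
  using Ck_inverse[OF Ck_speed] pos
  by (simp add: slowness_def[abs_def] divide_inverse less_imp_neq[symmetric])

lemma periodic_slowness: "lattice_periodic slowness"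
  unfolding slowness_def[abs_def] by (rule lattice_periodic_to_torus)

lemma slowness_pos: "0 < slowness x"
  using pos by (simp add: slowness_def)

lemma continuous_slowness: "continuous_on UNIV slowness"
  using Ck_slowness by (rule Ck_imp_continuous)

lemma speed_bounded: obtains M where "M > 0" "\<And>z. \<phi> z \<le> M"
proof -
  obtain M where "M > 0" "\<And>x. norm (\<phi> (to_torus x)) \<le> M"
    using periodic_bounded[OF lattice_periodic_to_torus Ck_imp_continuous[OF Ck_speed]] by metis
  moreover have "\<phi> z \<le> M" for z
    using calculation(2) by (metis abs_le_D1 real_norm_def to_torus_surj)
  ultimately show thesis using that by blast
qed

lemma mean_slowness_pos: "0 < mean_slowness"
proof -
  have int: "integrable cell slowness" by (intro integrable_cell periodic_slowness continuous_slowness)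
  have "0 \<le> mean_slowness" unfolding mean_slowness_def by (intro Bochner_Integration.integral_nonneg) (simp add: slowness_pos less_imp_le)
  moreover have "mean_slowness \<noteq> 0"
    using integral_cell_eq_0_imp_eq_0[OF periodic_slowness continuous_slowness, of 0] slowness_pos
    by (auto simp: mean_slowness_def less_imp_le less_imp_neq[symmetric])
  ultimately show ?thesis by simp
qed

lemma integral_curve:
  obtains c where "c 0 = x" "\<And>t. (c has_vector_derivative \<phi> (to_torus (c t)) *\<^sub>R \<alpha>) (at t)"
    "F 1 (to_torus x) = to_torus (c 1)"
  using flow unfolding generates_flow_def by metis

text \<open>Gronwall's inequality for the squared distance of two integral curves.  Continuity of the time-one
map makes observables composed with its iterates measurable, so that the integrals defining the
correlations are genuine.\<close>

lemma lipschitz_time_one: obtains L where "L-lipschitz_on UNIV (F 1)"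
proof -
  obtain l where l: "l-lipschitz_on UNIV (\<lambda>x. \<phi> (to_torus x))"
    using Ck_Suc_imp_lipschitz[OF lattice_periodic_to_torus Ck_speed] by blast
  define K where "K = 2 * (l * norm \<alpha>)"
  have "dist (F 1 (to_torus x)) (F 1 (to_torus y)) \<le> exp (K / 2) * dist x y" for x y
  proof -
    obtain a where a: "a 0 = x" "\<And>t. (a has_vector_derivative \<phi> (to_torus (a t)) *\<^sub>R \<alpha>) (at t)"
      "F 1 (to_torus x) = to_torus (a 1)" using integral_curve[of x] by blast
    obtain b where b: "b 0 = y" "\<And>t. (b has_vector_derivative \<phi> (to_torus (b t)) *\<^sub>R \<alpha>) (at t)"
      "F 1 (to_torus y) = to_torus (b 1)" using integral_curve[of y] by blast
    define w where "w t = a t - b t" for t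
    define v where "v t = \<phi> (to_torus (a t)) - \<phi> (to_torus (b t))" for t
    have w: "(w has_vector_derivative v t *\<^sub>R \<alpha>) (at t)" for t
      unfolding w_def[abs_def] v_def scaleR_diff_left
      by (intro has_vector_derivative_diff a b)
    have sq: "((\<lambda>t. w t \<bullet> w t) has_real_derivative 2 * (v t * (w t \<bullet> \<alpha>))) (at t)" for t
      using w[of t] unfolding has_vector_derivative_def has_field_derivative_def
      by (auto intro!: derivative_eq_intros simp: fun_eq_iff inner_commute algebra_simps)
    have le: "2 * (v t * (w t \<bullet> \<alpha>)) \<le> K * (w t \<bullet> w t)" for t
    proof -
      have "v t * (w t \<bullet> \<alpha>) \<le> \<bar>v t\<bar> * \<bar>w t \<bullet> \<alpha>\<bar>" by (metis abs_ge_self abs_mult)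
      also have "\<dots> \<le> (l * norm (w t)) * (norm (w t) * norm \<alpha>)"
        using lipschitz_onD[OF l, of "a t" "b t"] Cauchy_Schwarz_ineq2[of "w t" \<alpha>]
        by (intro mult_mono) (auto simp: v_def w_def dist_norm dist_real_def)
      finally show ?thesis
        by (simp add: K_def dot_square_norm power2_eq_square mult_ac)
    qed
    have "((\<lambda>t. (w t \<bullet> w t) * exp (- K * t)) has_real_derivative
        (2 * (v t * (w t \<bullet> \<alpha>)) - K * (w t \<bullet> w t)) * exp (- K * t)) (at t)" for t
      by (auto intro!: derivative_eq_intros sq simp: algebra_simps)
    moreover have "(2 * (v t * (w t \<bullet> \<alpha>)) - K * (w t \<bullet> w t)) * exp (- K * t) \<le> 0" for t
      using le[of t] by (intro mult_nonpos_nonneg) auto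
    ultimately have "(w 1 \<bullet> w 1) * exp (- K * 1) \<le> (w 0 \<bullet> w 0) * exp (- K * 0)"
      by (intro DERIV_nonpos_imp_nonincreasing[where f = "\<lambda>t. (w t \<bullet> w t) * exp (- K * t)"]) auto
    then have "(norm (w 1))\<^sup>2 * exp (- K) \<le> (norm (w 0))\<^sup>2" by (simp add: dot_square_norm)
    then have "(norm (w 1))\<^sup>2 * exp (- K) * exp K \<le> (norm (w 0))\<^sup>2 * exp K"
      by (intro mult_right_mono) auto
    moreover have "(norm (w 1))\<^sup>2 * exp (- K) * exp K = (norm (w 1))\<^sup>2"
      by (simp add: exp_minus)
    moreover have "(norm (w 0))\<^sup>2 * exp K = (exp (K / 2) * norm (w 0))\<^sup>2"
      using exp_double[of "K / 2"] by (simp add: power_mult_distrib)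
    ultimately have "(norm (w 1))\<^sup>2 \<le> (exp (K / 2) * norm (w 0))\<^sup>2" by simp
    then have "norm (w 1) \<le> exp (K / 2) * norm (w 0)"
      by (rule power2_le_imp_le) simp
    then have "dist (a 1) (b 1) \<le> exp (K / 2) * dist x y"
      by (simp add: w_def a(1) b(1) dist_norm)
    then show ?thesis
      using dist_to_torus_le[of "a 1" "b 1"] by (simp add: a(3) b(3))
  qed
  then have "(exp (K / 2))-lipschitz_on UNIV (\<lambda>x. F 1 (to_torus x))"
    by (intro lipschitz_onI) auto
  then show thesis using that lipschitz_on_torusI by blast
qed

lemma continuous_time_one_iterate: "continuous_on UNIV (F 1 ^^ N)"
proof (induction N)
  case (Suc N)
  obtain L where "L-lipschitz_on UNIV (F 1)" by (rule lipschitz_time_one)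
  then have "continuous_on UNIV (F 1)" by (rule lipschitz_on_continuous_on)
  then show ?case
    unfolding funpow.simps by (intro continuous_on_compose Suc) (auto elim: continuous_on_subset)
qed (simp add: id_def)

abbreviation \<mu> :: "'n torus measure" where
  "\<mu> \<equiv> reparam_measure \<phi>"

lemma
  fixes f :: "'n torus \<Rightarrow> 'b::{banach, second_countable_topology}"
  assumes f: "continuous_on UNIV f"
  shows integrable_reparam: "integrable \<mu> f"
    and integral_reparam: "integral\<^sup>L \<mu> f = (\<integral>x. (slowness x / mean_slowness) *\<^sub>R f (to_torus x) \<partial>cell)"
proof -
  have [measurable]: "f \<in> borel_measurable borel" "\<phi> \<in> borel_measurable borel"
    by (intro borel_measurable_continuous_onI f continuous_speed)+
  have [measurable]: "to_torus \<in> measurable cell borel"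
    by (intro measurable_restrict_space1) simp
  have tot: "(\<integral>y. 1 / \<phi> y \<partial>torus_lebesgue) = mean_slowness"
    unfolding torus_lebesgue_def mean_slowness_def slowness_def[abs_def] by (subst integral_distr) auto
  define D where "D x = 1 / \<phi> x / mean_slowness" for x
  have [measurable]: "D \<in> borel_measurable borel" unfolding D_def[abs_def] by measurable
  have D0: "0 \<le> D x" for x using pos[of x] mean_slowness_pos by (simp add: D_def)
  have mu: "\<mu> = density torus_lebesgue (\<lambda>x. ennreal (D x))"
    by (simp add: reparam_measure_def tot D_def)
  have Dm: "D \<in> borel_measurable torus_lebesgue" "f \<in> borel_measurable torus_lebesgue"
    by (simp_all add: torus_lebesgue_def)
  have fc: "continuous_on UNIV (\<lambda>x. f (to_torus x))"
    using continuous_on_compose2[OF f continuous_to_torus] by simp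
  have "integrable cell (\<lambda>x. (slowness x / mean_slowness) *\<^sub>R f (to_torus x))"
    by (intro integrable_cell lattice_periodic_comp2[where f = "\<lambda>u v. (u / mean_slowness) *\<^sub>R v"]
        periodic_slowness lattice_periodic_to_torus continuous_intros continuous_slowness fc)
       (use mean_slowness_pos in auto)
  then show "integrable \<mu> f"
    unfolding mu using D0 Dm
    by (subst integrable_density)
       (auto simp: torus_lebesgue_def integrable_distr_eq D_def slowness_def)
  show "integral\<^sup>L \<mu> f = (\<integral>x. (slowness x / mean_slowness) *\<^sub>R f (to_torus x) \<partial>cell)"
    unfolding mu using D0 Dm
    by (subst integral_density)
       (auto simp: torus_lebesgue_def integral_distr D_def slowness_def)
qed

lemma integral_reparam_const:
  fixes a :: "'b::{banach, second_countable_topology}"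
  shows "(\<integral>z. a \<partial>\<mu>) = a"
proof -
  have "(\<integral>z. a \<partial>\<mu>) = (\<integral>x. (slowness x / mean_slowness) *\<^sub>R a \<partial>cell)" by (rule integral_reparam) simp
  also have "\<dots> = (mean_slowness / mean_slowness) *\<^sub>R a"
    using integrable_cell[OF periodic_slowness continuous_slowness]
    by (simp add: mean_slowness_def)
  finally show ?thesis using mean_slowness_pos by simp
qed

lemma measure_reparam [simp]: "measure \<mu> (space \<mu>) = 1"
  using integral_reparam_const[of "1 :: real"] by simp

section \<open>Correlations of a rotating phase\<close>

lemma iterate_phase:
  assumes "\<And>x. \<exists>y. F 1 (to_torus x) = to_torus y \<and> \<bar>\<theta> y - \<theta> x - \<omega>\<bar> \<le> \<delta>"
  shows "\<exists>y. (F 1 ^^ N) (to_torus x) = to_torus y \<and> \<bar>\<theta> y - \<theta> x - real N * \<omega>\<bar> \<le> real N * \<delta>"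
proof (induction N)
  case (Suc N)
  then obtain y where y: "(F 1 ^^ N) (to_torus x) = to_torus y"
    "\<bar>\<theta> y - \<theta> x - real N * \<omega>\<bar> \<le> real N * \<delta>" by blast
  obtain y' where y': "F 1 (to_torus y) = to_torus y'" "\<bar>\<theta> y' - \<theta> y - \<omega>\<bar> \<le> \<delta>"
    using assms by blast
  have "\<bar>\<theta> y' - \<theta> x - real (Suc N) * \<omega>\<bar> \<le> real (Suc N) * \<delta>"
    using y(2) y'(2) by (simp add: algebra_simps)
  then show ?case using y y' by auto
qed auto

text \<open>Expanding the square turns the variance of a unimodular function into the defect of its mean from
modulus one.\<close>

lemma one_minus_norm_sq_mean:
  fixes G :: "'n torus \<Rightarrow> complex"
  assumes "continuous_on UNIV G" "\<And>z. norm (G z) = 1"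
  shows "(\<integral>z. (norm (G z - integral\<^sup>L \<mu> G))\<^sup>2 \<partial>\<mu>) = 1 - (norm (integral\<^sup>L \<mu> G))\<^sup>2"
proof -
  define Z where "Z = integral\<^sup>L \<mu> G"
  have eq: "(norm (G z - Z))\<^sup>2 = (1 + (norm Z)\<^sup>2) - 2 * Re (G z * cnj Z)" for z
  proof -
    have "(norm (G z - Z))\<^sup>2 = (norm (G z))\<^sup>2 + (norm Z)\<^sup>2 - 2 * Re (G z * cnj Z)"
      unfolding cmod_power2 by (simp add: power2_eq_square algebra_simps)
    then show ?thesis by (simp add: assms(2))
  qed
  have int: "integrable \<mu> G" by (rule integrable_reparam[OF assms(1)])
  have "(\<integral>z. (norm (G z - Z))\<^sup>2 \<partial>\<mu>) = (\<integral>z. 1 + (norm Z)\<^sup>2 \<partial>\<mu>) - (\<integral>z. 2 * Re (G z * cnj Z) \<partial>\<mu>)"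
    unfolding eq using int
    by (intro Bochner_Integration.integral_diff integrable_reparam continuous_intros assms) 
  also have "(\<integral>z. 1 + (norm Z)\<^sup>2 \<partial>\<mu>) = 1 + (norm Z)\<^sup>2" by (rule integral_reparam_const)
  also have "(\<integral>z. 2 * Re (G z * cnj Z) \<partial>\<mu>) = 2 * Re (Z * cnj Z)"
    using int by (simp add: Z_def)
  also have "Re (Z * cnj Z) = (norm Z)\<^sup>2"
    unfolding cmod_power2 by (simp add: power2_eq_square)
  finally show ?thesis by (simp add: Z_def)
qed

text \<open>The density of the invariant measure is bounded below, so a variance is at least a
constant multiple of a squared \<open>L\<^sup>2\<close> distance for Lebesgue measure.\<close>

lemma weight_lower_bound: obtains c where "c > 0" "\<And>x. c \<le> slowness x / mean_slowness"
proof -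
  obtain M where M: "M > 0" "\<And>z. \<phi> z \<le> M" using speed_bounded by blast
  have "1 / M / mean_slowness \<le> slowness x / mean_slowness" for x
    using M(2)[of "to_torus x"] pos[of "to_torus x"] mean_slowness_pos
    unfolding slowness_def by (intro divide_right_mono divide_left_mono mult_pos_pos M(1)) auto
  moreover have "1 / M / mean_slowness > 0" using M(1) mean_slowness_pos by simp
  ultimately show thesis using that by blast
qed

definition phase_mean :: "(real ^ 'n \<Rightarrow> real) \<Rightarrow> complex" where
  "phase_mean \<theta> = integral\<^sup>L \<mu> (descend (\<lambda>x. cis (\<theta> x)))"

text \<open>Suppose that one step of the dynamics rotates the unimodular function
\<open>cis \<circ> \<theta>\<close> by the angle \<open>\<omega>\<close>, up to an error
\<open>\<delta>\<close>.  After \<open>N\<close> steps the function still has correlation with itself of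
modulus at least \<open>1 - N \<delta>\<close>.  If correlations are small at time \<open>N\<close>, the
square of the modulus of its mean must therefore be almost \<open>1\<close>, that is, its variance
must be small.  The complex correlation is assembled from the four real correlations of cosine and
sine, whence the factor \<open>4\<close>.\<close>

lemma phase_correlation:
  fixes \<theta> :: "real ^ 'n \<Rightarrow> real"
  assumes lip: "L-lipschitz_on UNIV \<theta>" and per: "lattice_periodic (\<lambda>x. cis (\<theta> x))"
    and rot: "\<And>x. \<exists>y. F 1 (to_torus x) = to_torus y \<and> \<bar>\<theta> y - \<theta> x - \<omega>\<bar> \<le> \<delta>"
    and decay: "\<And>f g. is_lipschitz f \<Longrightarrow> is_lipschitz g \<Longrightarrow>
        \<bar>(\<integral>x. f ((F 1 ^^ N) x) * g x \<partial>\<mu>) - (\<integral>x. f x \<partial>\<mu>) * (\<integral>x. g x \<partial>\<mu>)\<bar>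
          \<le> lipschitz_norm f * lipschitz_norm g * K"
    and K: "0 \<le> K" and c: "\<And>x. c \<le> slowness x / mean_slowness"
  shows "c * (\<integral>x. (norm (cis (\<theta> x) - phase_mean \<theta>))\<^sup>2 \<partial>cell)
    \<le> real N * \<delta> + 4 * ((1 + real CARD('n) * L)\<^sup>2 * K)"
proof -
  define G where "G = descend (\<lambda>x. cis (\<theta> x))"
  have Gx: "G (to_torus x) = cis (\<theta> x)" for x by (simp add: G_def per)
  have clip: "L-lipschitz_on UNIV (\<lambda>x. cis (\<theta> x))"
  proof (rule lipschitz_onI[OF _ lipschitz_on_nonneg[OF lip]])
    fix x y
    show "dist (cis (\<theta> x)) (cis (\<theta> y)) \<le> L * dist x y"
      using cis_lipschitz[of "\<theta> x" "\<theta> y"] lipschitz_onD[OF lip, of x y]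
      by (simp add: dist_norm)
  qed
  have Glip: "(real CARD('n) * L)-lipschitz_on UNIV G"
    by (rule lipschitz_on_torusI) (simp add: Gx clip)
  have Gc: "continuous_on UNIV G" using Glip by (rule lipschitz_on_continuous_on)
  have Gn: "norm (G z) = 1" for z by (metis Gx norm_cis to_torus_surj)
  define T where "T = F 1 ^^ N"
  have Tc: "continuous_on UNIV T" unfolding T_def by (rule continuous_time_one_iterate)
  have GT: "continuous_on UNIV (\<lambda>z. G (T z))" using continuous_on_compose2[OF Gc Tc] by simp
  define Z where "Z = integral\<^sup>L \<mu> G"
  define a where "a z = Re (G z)" for z
  define b where "b z = Im (G z)" for z
  have alip: "(real CARD('n) * L)-lipschitz_on UNIV a"
    using Glip unfolding lipschitz_on_def a_def dist_norm
    by (auto intro: order_trans[OF abs_Re_le_cmod, of "_ - _", simplified])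
  have blip: "(real CARD('n) * L)-lipschitz_on UNIV b"
    using Glip unfolding lipschitz_on_def b_def dist_norm
    by (auto intro: order_trans[OF abs_Im_le_cmod, of "_ - _", simplified])
  have ab1: "\<bar>a z\<bar> \<le> 1" "\<bar>b z\<bar> \<le> 1" for z
    using abs_Re_le_cmod[of "G z"] abs_Im_le_cmod[of "G z"] by (auto simp: a_def b_def Gn)
  define W where "W = (1 + real CARD('n) * L)\<^sup>2 * K"
  define R where "R f g = (\<integral>x. f (T x) * g x \<partial>\<mu>) - (\<integral>x. f x \<partial>\<mu>) * (\<integral>x. g x \<partial>\<mu>)" for f g :: "'n torus \<Rightarrow> real"
  have R: "\<bar>R f g\<bar> \<le> W" if "f \<in> {a, b}" "g \<in> {a, b}" for f g
  proof -
    have *: "(real CARD('n) * L)-lipschitz_on UNIV h" "\<And>z. \<bar>h z\<bar> \<le> 1" if "h \<in> {a, b}" for h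
      using that alip blip ab1 by auto
    have "\<bar>R f g\<bar> \<le> lipschitz_norm f * lipschitz_norm g * K"
      unfolding R_def T_def using * that by (intro decay) (auto simp: is_lipschitz_def)
    also have "\<dots> \<le> W"
      unfolding W_def power2_eq_square
      using lipschitz_norm_le[OF *(1)[OF that(1)] *(2)[OF that(1)]]
        lipschitz_norm_le[OF *(1)[OF that(2)] *(2)[OF that(2)]]
      by (intro mult_right_mono mult_mono K) auto
    finally show ?thesis .
  qed
  define C where "C = (\<integral>z. G (T z) * cnj (G z) \<partial>\<mu>)"
  have ac: "continuous_on UNIV a" "continuous_on UNIV b"
    unfolding a_def[abs_def] b_def[abs_def] by (intro continuous_intros Gc)+
  have aT: "continuous_on UNIV (\<lambda>z. a (T z))" "continuous_on UNIV (\<lambda>z. b (T z))"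
    unfolding a_def[abs_def] b_def[abs_def] by (intro continuous_intros GT)+
  have intC: "integrable \<mu> (\<lambda>z. G (T z) * cnj (G z))"
    by (intro integrable_reparam continuous_intros GT Gc)
  have ReC: "Re C = (\<integral>z. a (T z) * a z \<partial>\<mu>) + (\<integral>z. b (T z) * b z \<partial>\<mu>)"
  proof -
    have "Re C = (\<integral>z. a (T z) * a z + b (T z) * b z \<partial>\<mu>)"
      unfolding C_def integral_Re[OF intC, symmetric] by (simp add: a_def b_def)
    then show ?thesis
      by (simp add: Bochner_Integration.integral_add integrable_reparam continuous_on_mult ac aT)
  qed
  have ImC: "Im C = (\<integral>z. b (T z) * a z \<partial>\<mu>) - (\<integral>z. a (T z) * b z \<partial>\<mu>)"
  proof -
    have "Im C = (\<integral>z. b (T z) * a z - a (T z) * b z \<partial>\<mu>)"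
      unfolding C_def integral_Im[OF intC, symmetric] by (simp add: a_def b_def)
    then show ?thesis
      by (simp add: Bochner_Integration.integral_diff integrable_reparam continuous_on_mult ac aT)
  qed
  have ReZ: "integral\<^sup>L \<mu> a = Re Z" and ImZ: "integral\<^sup>L \<mu> b = Im Z"
    using integrable_reparam[OF Gc] by (simp_all add: Z_def a_def[abs_def] b_def[abs_def])
  have "(norm Z)\<^sup>2 = Re Z * Re Z + Im Z * Im Z"
    using cmod_power2[of Z] by (simp only: power2_eq_square)
  then have "Re (C - (norm Z)\<^sup>2) = R a a + R b b"
    by (simp add: ReC R_def ReZ ImZ del: of_real_power)
  moreover have "Im (C - (norm Z)\<^sup>2) = R b a - R a b"
    by (simp add: ImC R_def ReZ ImZ)
  ultimately have corr: "norm (C - (norm Z)\<^sup>2) \<le> 4 * W"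
    using cmod_le[of "C - (norm Z)\<^sup>2"] R[of a a] R[of b b] R[of a b] R[of b a] by auto
  have "norm (C - cis (real N * \<omega>)) \<le> real N * \<delta>"
  proof -
    have pt: "norm (G (T z) * cnj (G z) - cis (real N * \<omega>)) \<le> real N * \<delta>" for z
    proof -
      obtain x where x: "z = to_torus x" by (rule to_torus_surj)
      obtain y where y: "T z = to_torus y" "\<bar>\<theta> y - \<theta> x - real N * \<omega>\<bar> \<le> real N * \<delta>"
        using iterate_phase[where \<theta> = \<theta> and x = x and N = N, OF rot] unfolding T_def x by blast
      have "G (T z) * cnj (G z) = cis (\<theta> y - \<theta> x)"
        by (simp add: x y[unfolded x] Gx cis_cnj cis_mult)
      then show ?thesis
        using cis_lipschitz[of "\<theta> y - \<theta> x" "real N * \<omega>"] y(2) by simp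
    qed
    have "C - cis (real N * \<omega>) = (\<integral>z. G (T z) * cnj (G z) - cis (real N * \<omega>) \<partial>\<mu>)"
      using intC integrable_reparam[of "\<lambda>_. cis (real N * \<omega>)"]
      by (subst Bochner_Integration.integral_diff) (auto simp: C_def integral_reparam_const)
    also have "norm \<dots> \<le> (\<integral>z. norm (G (T z) * cnj (G z) - cis (real N * \<omega>)) \<partial>\<mu>)" by simp
    also have "\<dots> \<le> (\<integral>z. real N * \<delta> \<partial>\<mu>)"
      by (intro Bochner_Integration.integral_mono integrable_reparam continuous_intros GT Gc pt)
    finally show ?thesis by (simp add: integral_reparam_const)
  qed
  then have "1 - (norm Z)\<^sup>2 \<le> real N * \<delta> + 4 * W"
  proof -
    have "1 = norm (cis (real N * \<omega>))" by simp
    also have "\<dots> \<le> norm (C - (norm Z)\<^sup>2) + norm (C - cis (real N * \<omega>)) + norm (complex_of_real ((norm Z)\<^sup>2))"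
      by (smt (verit) norm_triangle_ineq norm_triangle_ineq4 diff_add_cancel norm_minus_commute)
    finally show ?thesis
      using corr \<open>norm (C - cis (real N * \<omega>)) \<le> real N * \<delta>\<close> by (simp del: of_real_power)
  qed
  moreover have "c * (\<integral>x. (norm (cis (\<theta> x) - Z))\<^sup>2 \<partial>cell) \<le> 1 - (norm Z)\<^sup>2"
  proof -
    have thc: "continuous_on UNIV (\<lambda>x. cis (\<theta> x))" using clip by (rule lipschitz_on_continuous_on)
    have "c * (\<integral>x. (norm (cis (\<theta> x) - Z))\<^sup>2 \<partial>cell) = (\<integral>x. c * (norm (cis (\<theta> x) - Z))\<^sup>2 \<partial>cell)"
      by simp
    also have "\<dots> \<le> (\<integral>x. slowness x / mean_slowness * (norm (cis (\<theta> x) - Z))\<^sup>2 \<partial>cell)"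
      by (intro Bochner_Integration.integral_mono integrable_cell continuous_intros thc continuous_slowness
          lattice_periodic_comp[OF per, of "\<lambda>u. c * (norm (u - Z))\<^sup>2"]
          lattice_periodic_comp2[OF periodic_slowness per, of "\<lambda>s u. s / mean_slowness * (norm (u - Z))\<^sup>2"]
          mult_right_mono c) (use mean_slowness_pos in auto)
    also have "\<dots> = (\<integral>z. (norm (G z - Z))\<^sup>2 \<partial>\<mu>)"
      by (subst integral_reparam) (auto intro!: continuous_intros Gc simp: Gx)
    also have "\<dots> = 1 - (norm Z)\<^sup>2"
      unfolding Z_def by (rule one_minus_norm_sq_mean[OF Gc Gn])
    finally show ?thesis .
  qed
  ultimately show ?thesis unfolding W_def phase_mean_def Z_def G_def by linarith
qed


section \<open>Power-law decay is impossible\<close>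

text \<open>Decay at the rate \<open>n powr (- 1 / r)\<close>, tested only at the times \<open>n = j ^ r\<close>,
where the rate is simply \<open>1 / j\<close>.\<close>

definition decays_along_powers :: "nat \<Rightarrow> nat \<Rightarrow> bool" where
  "decays_along_powers r j0 \<longleftrightarrow> (\<forall>j\<ge>j0. \<forall>f g. is_lipschitz f \<longrightarrow> is_lipschitz g \<longrightarrow>
     \<bar>(\<integral>x. f ((F 1 ^^ (j ^ r)) x) * g x \<partial>\<mu>) - (\<integral>x. f x \<partial>\<mu>) * (\<integral>x. g x \<partial>\<mu>)\<bar>
       \<le> lipschitz_norm f * lipschitz_norm g * (1 / real j))"

text \<open>If \<open>freq k \<bullet> \<alpha>\<close> is tiny, the character with frequency \<open>k\<close> is almost
invariant for a long time, although its Lipschitz norm is only of the order of the height of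
\<open>k\<close> and its variance is bounded below.  Decay of correlations at a time that is a power of
the height thus forces a lower bound on \<open>freq k \<bullet> \<alpha>\<close> by a negative power of
the height.\<close>

lemma decay_imp_diophantine:
  assumes slow: "decays_along_powers r j0"
  obtains c :: real and \<tau> :: nat where "c > 0" "\<And>k. k \<noteq> 0 \<Longrightarrow> c / real (height k) ^ \<tau> \<le> \<bar>freq k \<bullet> \<alpha>\<bar>"
proof -
  obtain c0 where c0: "c0 > 0" "\<And>x. c0 \<le> slowness x / mean_slowness" using weight_lower_bound by blast
  obtain M where M: "M > 0" "\<And>z. \<phi> z \<le> M" using speed_bounded by blast
  define n where "n = real CARD('n)"
  have corr: "c0 \<le> real (j ^ r) * (2 * pi * (M * \<bar>freq k \<bullet> \<alpha>\<bar>))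
      + 4 * ((1 + n * (2 * pi * real (height k)))\<^sup>2 * (1 / real j))"
    if k: "k \<noteq> 0" and j: "j \<ge> j0" for k j
  proof -
    define \<theta> where "\<theta> x = 2 * pi * (freq k \<bullet> x)" for x
    have ch: "cis (\<theta> x) = character k x" for x by (simp add: \<theta>_def character_def)
    define Z where "Z = phase_mean \<theta>"
    have "c0 * (\<integral>x. (norm (cis (\<theta> x) - Z))\<^sup>2 \<partial>cell)
        \<le> real (j ^ r) * (2 * pi * (M * \<bar>freq k \<bullet> \<alpha>\<bar>))
          + 4 * ((1 + real CARD('n) * (2 * pi * real (height k)))\<^sup>2 * (1 / real j))"
      unfolding Z_def
    proof (rule phase_correlation[where \<omega> = 0])
      show "(2 * pi * real (height k))-lipschitz_on UNIV \<theta>"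
      proof (rule lipschitz_onI)
        fix x y
        have "dist (\<theta> x) (\<theta> y) = 2 * pi * \<bar>freq k \<bullet> (x - y)\<bar>"
          by (simp add: \<theta>_def dist_real_def inner_diff_right abs_mult right_diff_distrib[symmetric])
        also have "\<bar>freq k \<bullet> (x - y)\<bar> \<le> norm (freq k) * norm (x - y)" by (rule Cauchy_Schwarz_ineq2)
        also have "\<dots> \<le> real (height k) * norm (x - y)"
          by (intro mult_right_mono norm_freq_le_height) auto
        finally show "dist (\<theta> x) (\<theta> y) \<le> 2 * pi * real (height k) * dist x y"
          by (simp add: dist_norm mult_ac)
      qed simp
      show "lattice_periodic (\<lambda>x. cis (\<theta> x))" by (simp add: ch)
      fix x
      obtain c where c: "c 0 = x" "\<And>t. (c has_vector_derivative \<phi> (to_torus (c t)) *\<^sub>R \<alpha>) (at t)"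
        "F 1 (to_torus x) = to_torus (c 1)" using integral_curve[of x] by blast
      have der: "((\<lambda>t. \<theta> (c t)) has_real_derivative 2 * pi * (\<phi> (to_torus (c t)) * (freq k \<bullet> \<alpha>))) (at t)" for t
        using c(2)[of t] unfolding has_vector_derivative_def has_field_derivative_def \<theta>_def
        by (auto intro!: derivative_eq_intros simp: fun_eq_iff algebra_simps)
      have "norm (\<theta> (c 1) - \<theta> (c 0)) \<le> (2 * pi * (M * \<bar>freq k \<bullet> \<alpha>\<bar>)) * norm (1 - 0 :: real)"
      proof (rule field_differentiable_bound[OF convex_UNIV])
        show "((\<lambda>t. \<theta> (c t)) has_real_derivative 2 * pi * (\<phi> (to_torus (c t)) * (freq k \<bullet> \<alpha>))) (at t within UNIV)" for t
          using der by simp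
        show "norm (2 * pi * (\<phi> (to_torus (c t)) * (freq k \<bullet> \<alpha>))) \<le> 2 * pi * (M * \<bar>freq k \<bullet> \<alpha>\<bar>)" for t
          using M(2)[of "to_torus (c t)"] pos[of "to_torus (c t)"]
          by (auto simp: abs_mult intro!: mult_left_mono mult_right_mono)
      qed auto
      then show "\<exists>y. F 1 (to_torus x) = to_torus y \<and> \<bar>\<theta> y - \<theta> x - 0\<bar> \<le> 2 * pi * (M * \<bar>freq k \<bullet> \<alpha>\<bar>)"
        using c by auto
    next
      fix f g :: "'n torus \<Rightarrow> real" assume "is_lipschitz f" "is_lipschitz g"
      then show "\<bar>(\<integral>x. f ((F 1 ^^ (j ^ r)) x) * g x \<partial>\<mu>) - (\<integral>x. f x \<partial>\<mu>) * (\<integral>x. g x \<partial>\<mu>)\<bar>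
          \<le> lipschitz_norm f * lipschitz_norm g * (1 / real j)"
        using slow j unfolding decays_along_powers_def by blast
    qed (use c0 in auto)
    then have Z: "c0 * (\<integral>x. (norm (character k x - Z))\<^sup>2 \<partial>cell)
        \<le> real (j ^ r) * (2 * pi * (M * \<bar>freq k \<bullet> \<alpha>\<bar>))
          + 4 * ((1 + n * (2 * pi * real (height k)))\<^sup>2 * (1 / real j))"
      unfolding ch n_def .
    have "(\<integral>x. (norm (character k x - Z))\<^sup>2 \<partial>cell) = 1 + (norm Z)\<^sup>2"
    proof -
      have eq: "(norm (character k x - Z))\<^sup>2 = (1 + (norm Z)\<^sup>2) - 2 * Re (character k x * cnj Z)" for x
      proof -
        have "(norm (character k x - Z))\<^sup>2 = (norm (character k x))\<^sup>2 + (norm Z)\<^sup>2 - 2 * Re (character k x * cnj Z)"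
          unfolding cmod_power2 by (simp add: power2_eq_square algebra_simps)
        then show ?thesis by simp
      qed
      have int: "integrable cell (character k)"
        by (intro integrable_cell lattice_periodic_character continuous_on_character)
      show ?thesis
        unfolding eq using int
        by (subst Bochner_Integration.integral_diff) (auto simp: integral_character k)
    qed
    then have "c0 * 1 \<le> c0 * (\<integral>x. (norm (character k x - Z))\<^sup>2 \<partial>cell)"
      using c0(1) by (intro mult_left_mono) auto
    with Z show ?thesis by simp
  qed
  define b where "b = 4 * (1 + 2 * pi * n)\<^sup>2"
  have b0: "b > 0" unfolding b_def n_def by (intro mult_pos_pos zero_less_power add_pos_nonneg) auto
  \<comment> \<open>\<open>J\<close> makes the decay term, at the time belonging to \<open>j = J * height k ^ 2\<close>, at most
half of the variance bound\<close>
  obtain J where J: "J \<ge> j0" "J \<ge> 1" "2 * b / c0 \<le> real J"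
  proof -
    obtain m where "2 * b / c0 \<le> real m" using real_arch_simple by blast
    then show thesis by (intro that[of "max m (max j0 1)"]) auto
  qed
  define c where "c = c0 / (4 * pi * M * real J ^ r)"
  have "c > 0" using c0(1) M(1) J(2) by (simp add: c_def)
  moreover have "c / real (height k) ^ (2 * r) \<le> \<bar>freq k \<bullet> \<alpha>\<bar>" if k: "k \<noteq> 0" for k
  proof -
    define A where "A = real (height k)"
    have A: "1 \<le> A" using height_pos[OF k] by (simp add: A_def)
    define j where "j = J * height k ^ 2"
    have rj: "real j = real J * A\<^sup>2" by (simp add: j_def A_def)
    have "J * 1 \<le> J * height k ^ 2"
      using height_pos[OF k] by (intro mult_le_mono2) simp
    then have "j \<ge> j0" using J(1) unfolding j_def by linarith
    from corr[OF k this]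
    have 1: "c0 \<le> real (j ^ r) * (2 * pi * (M * \<bar>freq k \<bullet> \<alpha>\<bar>)) + 4 * ((1 + n * (2 * pi * A))\<^sup>2 * (1 / real j))"
      by (simp add: A_def)
    have "1 + n * (2 * pi * A) \<le> (1 + 2 * pi * n) * A" using A by (simp add: algebra_simps)
    then have "(1 + n * (2 * pi * A))\<^sup>2 \<le> ((1 + 2 * pi * n) * A)\<^sup>2"
      using A by (intro power_mono add_nonneg_nonneg mult_nonneg_nonneg) (auto simp: n_def)
    then have "4 * ((1 + n * (2 * pi * A))\<^sup>2 * (1 / real j)) \<le> 4 * (((1 + 2 * pi * n) * A)\<^sup>2 * (1 / real j))"
      by (intro mult_left_mono mult_right_mono) auto
    also have "\<dots> = b / real J"
      using A J(2) by (simp add: rj b_def power_mult_distrib)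
    also have "\<dots> \<le> c0 / 2"
      using J(2,3) c0(1) by (simp add: field_simps)
    finally have "c0 / 2 \<le> real (j ^ r) * (2 * pi * (M * \<bar>freq k \<bullet> \<alpha>\<bar>))" using 1 by linarith
    also have "real (j ^ r) = real J ^ r * A ^ (2 * r)"
      by (simp add: rj power_mult_distrib power_mult)
    finally show ?thesis
      using J(2) A M(1) by (simp add: c_def A_def[symmetric] field_simps)
  qed
  ultimately show thesis using that by blast
qed

text \<open>Decay forces the direction to be Diophantine, so the cohomological equation for the reciprocal of the
speed has a Lipschitz solution \<open>u\<close>.  Correcting a linear phase by a multiple of \<open>u\<close>
turns it into a phase \<open>\<theta>\<close> that advances by exactly the same angle from every point:
\<open>cis \<circ> \<theta>\<close> is a Lipschitz eigenfunction of the time-one map, and its correlations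
do not decay at all unless it is constant.  It is not constant, because \<open>\<theta>\<close> grows by
\<open>2 \<pi>\<close> around a coordinate circle.\<close>

lemma no_power_decay: "\<not> decays_along_powers r j0"
proof
  assume slow: "decays_along_powers r j0"
  obtain c :: real and \<tau> :: nat
    where c: "c > 0" "\<And>k. k \<noteq> 0 \<Longrightarrow> c / real (height k) ^ \<tau> \<le> \<bar>freq k \<bullet> \<alpha>\<bar>"
    using decay_imp_diophantine[OF slow] by blast
  obtain M where M: "M > 0" "\<And>z. \<phi> z \<le> M" using speed_bounded by blast
  obtain u L where u: "lattice_periodic u" "L-lipschitz_on UNIV u"
    and coh: "\<And>x v E. \<lbrakk>\<And>t. (x has_vector_derivative v t *\<^sub>R \<alpha>) (at t);
        \<And>t. (E has_real_derivative v t * (slowness (x t) - integral\<^sup>L cell slowness)) (at t);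
        \<And>t. \<bar>v t\<bar> \<le> M\<rbrakk> \<Longrightarrow> u (x 1) - u (x 0) = E (1 :: real) - E 0"
    using cohomological_equation[OF periodic_slowness Ck_slowness c, where M = M] by blast
  define i :: 'n where "i = undefined"
  define k :: "int ^ 'n" where "k = axis i 1"
  have k: "k \<noteq> 0" by (simp add: k_def axis_eq_0_iff)
  have fk: "freq k = axis i 1" by (simp add: k_def vec_eq_iff axis_def)
  define s where "s = freq k \<bullet> \<alpha>"
  have s: "s \<noteq> 0"
  proof -
    have "0 < c / real (height k) ^ \<tau>" using c(1) height_pos[OF k] by simp
    then show ?thesis using c(2)[OF k] by (auto simp: s_def)
  qed
  define \<theta> where "\<theta> x = 2 * pi * (freq k \<bullet> x + s / mean_slowness * u x)" for x
  define l where "l = 2 * pi * (1 + \<bar>s / mean_slowness\<bar> * L)"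
  have \<theta>_lip: "l-lipschitz_on UNIV \<theta>"
  proof (rule lipschitz_onI)
    show "0 \<le> l" unfolding l_def using lipschitz_on_nonneg[OF u(2)] by simp
    fix x y
    have "\<bar>freq k \<bullet> (x - y)\<bar> \<le> norm (x - y)"
      using Cauchy_Schwarz_ineq2[of "freq k" "x - y"] by (simp add: fk norm_axis_1)
    moreover have "\<bar>s / mean_slowness * (u x - u y)\<bar> \<le> \<bar>s / mean_slowness\<bar> * (L * norm (x - y))"
      unfolding abs_mult using lipschitz_onD[OF u(2), of x y]
      by (intro mult_left_mono) (auto simp: dist_norm)
    ultimately have "\<bar>freq k \<bullet> (x - y) + s / mean_slowness * (u x - u y)\<bar> \<le> (1 + \<bar>s / mean_slowness\<bar> * L) * norm (x - y)"
      by (simp only: distrib_right mult_1_left mult.assoc)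
    then have "2 * pi * \<bar>freq k \<bullet> (x - y) + s / mean_slowness * (u x - u y)\<bar> \<le> l * norm (x - y)"
      unfolding l_def mult.assoc by (intro mult_left_mono) auto
    moreover have "\<theta> x - \<theta> y = 2 * pi * (freq k \<bullet> (x - y) + s / mean_slowness * (u x - u y))"
      by (simp add: \<theta>_def inner_diff_right right_diff_distrib distrib_left)
    ultimately show "dist (\<theta> x) (\<theta> y) \<le> l * dist x y"
      by (simp add: dist_real_def dist_norm abs_mult)
  qed
  have \<theta>_per: "lattice_periodic (\<lambda>x. cis (\<theta> x))"
  proof -
    have "(\<lambda>x. cis (\<theta> x)) = (\<lambda>x. character k x * cis (2 * pi * (s / mean_slowness * u x)))"
      by (simp add: \<theta>_def character_def cis_mult distrib_left)
    then show ?thesis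
      by (simp only: lattice_periodic_comp2[OF lattice_periodic_character u(1), of "\<lambda>a b. a * cis (2 * pi * (s / mean_slowness * b))"])
  qed
  have rot: "\<exists>y. F 1 (to_torus x) = to_torus y \<and> \<bar>\<theta> y - \<theta> x - 2 * pi * (s / mean_slowness)\<bar> \<le> 0" for x
  proof -
    obtain \<xi> where \<xi>: "\<xi> 0 = x" "\<And>t. (\<xi> has_vector_derivative \<phi> (to_torus (\<xi> t)) *\<^sub>R \<alpha>) (at t)"
      "F 1 (to_torus x) = to_torus (\<xi> 1)" using integral_curve[of x] by blast
    \<comment> \<open>the elapsed time minus the time that the linear flow with velocity \<open>\<alpha> / mean_slowness\<close> needs for
      the same displacement, up to an additive constant\<close>
    define E where "E t = t - mean_slowness / s * (freq k \<bullet> \<xi> t)" for t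
    have "(E has_real_derivative \<phi> (to_torus (\<xi> t)) * (slowness (\<xi> t) - integral\<^sup>L cell slowness)) (at t)" for t
    proof -
      have "((\<lambda>t. freq k \<bullet> \<xi> t) has_real_derivative \<phi> (to_torus (\<xi> t)) * s) (at t)"
        using \<xi>(2)[of t] unfolding has_vector_derivative_def has_field_derivative_def s_def
        by (auto intro!: derivative_eq_intros simp: fun_eq_iff algebra_simps)
      then have "(E has_real_derivative 1 - mean_slowness / s * (\<phi> (to_torus (\<xi> t)) * s)) (at t)"
        unfolding E_def[abs_def] by (auto intro!: derivative_eq_intros)
      moreover have "1 - mean_slowness / s * (\<phi> (to_torus (\<xi> t)) * s) = \<phi> (to_torus (\<xi> t)) * (slowness (\<xi> t) - integral\<^sup>L cell slowness)"
        using s pos[of "to_torus (\<xi> t)"] by (simp add: slowness_def[of "\<xi> t"] mean_slowness_def[symmetric] right_diff_distrib mult_ac)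
      ultimately show ?thesis by simp
    qed
    moreover have "\<bar>\<phi> (to_torus (\<xi> t))\<bar> \<le> M" for t
      using M(2) pos[of "to_torus (\<xi> t)"] by simp
    ultimately have "u (\<xi> 1) - u (\<xi> 0) = E 1 - E 0" 
      by (rule coh[of \<xi> "\<lambda>t. \<phi> (to_torus (\<xi> t))" E, OF \<xi>(2)])
    then have u_eq: "u (\<xi> 1) = u (\<xi> 0) + (E 1 - E 0)" by simp
    have "\<theta> (\<xi> 1) - \<theta> (\<xi> 0) = 2 * pi * (freq k \<bullet> \<xi> 1 - freq k \<bullet> \<xi> 0 + s / mean_slowness * (E 1 - E 0))"
      unfolding \<theta>_def u_eq by (simp add: distrib_left right_diff_distrib)
    also have "\<dots> = 2 * pi * (s / mean_slowness)"
      using s mean_slowness_pos by (simp add: E_def field_simps)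
    finally show ?thesis using \<xi>(1,3) by auto
  qed
  obtain c0 where c0: "c0 > 0" "\<And>x. c0 \<le> slowness x / mean_slowness" using weight_lower_bound by blast
  have \<theta>_cont: "continuous_on UNIV \<theta>" using \<theta>_lip by (rule lipschitz_on_continuous_on)
  define K where "K = 4 * (1 + real CARD('n) * l)\<^sup>2"
  define Z where "Z = phase_mean \<theta>"
  define V where "V = (\<integral>x. (norm (cis (\<theta> x) - Z))\<^sup>2 \<partial>cell)"
  have V_le: "c0 * V \<le> K / real j" if j: "j \<ge> j0" for j
  proof -
    have "c0 * V \<le> real (j ^ r) * 0 + 4 * ((1 + real CARD('n) * l)\<^sup>2 * (1 / real j))"
      unfolding V_def Z_def
    proof (rule phase_correlation[OF \<theta>_lip \<theta>_per rot])
      fix f g :: "'n torus \<Rightarrow> real" assume "is_lipschitz f" "is_lipschitz g"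
      then show "\<bar>(\<integral>x. f ((F 1 ^^ (j ^ r)) x) * g x \<partial>\<mu>) - (\<integral>x. f x \<partial>\<mu>) * (\<integral>x. g x \<partial>\<mu>)\<bar>
          \<le> lipschitz_norm f * lipschitz_norm g * (1 / real j)"
        using slow j unfolding decays_along_powers_def by blast
    qed (use c0 in auto)
    then show ?thesis by (simp add: K_def)
  qed
  have V_per: "lattice_periodic (\<lambda>x. (norm (cis (\<theta> x) - Z))\<^sup>2)"
    using lattice_periodic_comp[OF \<theta>_per, of "\<lambda>w. (norm (w - Z))\<^sup>2"] .
  have "c0 * V \<le> 0"
  proof (rule tendsto_lowerbound)
    show "(\<lambda>j. K / real j) \<longlonglongrightarrow> 0" by (rule lim_const_over_n)
    show "\<forall>\<^sub>F j in sequentially. c0 * V \<le> K / real j"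
      using V_le by (auto simp: eventually_sequentially)
  qed simp
  moreover have "0 \<le> V" unfolding V_def by (intro Bochner_Integration.integral_nonneg) simp
  ultimately have "V = 0" using c0(1) by (simp add: mult_le_0_iff)
  moreover have "continuous_on UNIV (\<lambda>x. (norm (cis (\<theta> x) - Z))\<^sup>2)"
    by (intro continuous_intros \<theta>_cont)
  ultimately have Z: "cis (\<theta> x) = Z" for x
    using integral_cell_eq_0_imp_eq_0[OF V_per, of x] by (simp add: V_def)
  \<comment> \<open>going once around a coordinate circle, the phase passes the value antipodal to its initial one\<close>
  have "\<exists>t. 0 \<le> t \<and> t \<le> 1 \<and> \<theta> (t *\<^sub>R axis i 1) = \<theta> 0 + pi"
  proof (rule IVT')
    have "u (axis i 1) = u 0"
      by (rule lattice_periodicD[OF u(1)]) (simp add: lattice_rel_def axis_def)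
    then show "\<theta> 0 + pi \<le> \<theta> (1 *\<^sub>R axis i 1)"
      by (simp add: \<theta>_def fk inner_axis_axis algebra_simps)
    show "continuous_on {0..1} (\<lambda>t. \<theta> (t *\<^sub>R axis i 1))"
      by (intro continuous_on_compose2[OF \<theta>_cont] continuous_intros) auto
  qed auto
  then obtain t where t: "\<theta> (t *\<^sub>R axis i 1) = \<theta> 0 + pi" by blast
  have "cis (\<theta> 0 + pi) = cis (\<theta> 0)" using Z t by metis
  then have "cis (\<theta> 0) = 0" by (simp add: cis_mult[symmetric])
  then show False using norm_cis[of "\<theta> 0"] by simp
qed

end

text \<open>A positive exponent exceeds some \<open>1 / r\<close>, so that eventually \<open>\<Phi> (j ^ r)\<close> is
at most \<open>1 / j\<close>.\<close>

lemma power_law_decay_exponent_le_0: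
  fixes \<alpha> :: "real ^ ('n::finite)"
  assumes "power_law_decay (reparam_measure \<phi>) (F 1) p"
    and flow: "reparametrized_flow \<alpha> \<phi> F"
  shows "p \<le> 0"
proof (rule ccontr)
  interpret reparametrized_flow \<alpha> \<phi> F by (rule flow)
  assume "\<not> p \<le> 0"
  then have "0 < p" by simp
  then obtain q where q: "0 < ereal q" "ereal q < p" using ereal_dense2 by blast
  then obtain r where r: "r > 0" "inverse (real r) < q"
    using ex_inverse_of_nat_less[of q] by auto
  from assms(1) obtain \<Phi> :: "nat \<Rightarrow> real" where \<Phi>: "\<And>n. 0 < \<Phi> n"
    and corr: "\<And>f g n. is_lipschitz f \<Longrightarrow> is_lipschitz g \<Longrightarrow>
        \<bar>(\<integral>x. f ((F 1 ^^ n) x) * g x \<partial>\<mu>) - (\<integral>x. f x \<partial>\<mu>) * (\<integral>x. g x \<partial>\<mu>)\<bar>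
          \<le> lipschitz_norm f * lipschitz_norm g * \<Phi> n"
    and lim: "(\<lambda>n. ereal (- ln (\<Phi> n) / ln (real n))) \<longlonglongrightarrow> p"
    unfolding power_law_decay_def by blast
  from order_tendstoD(1)[OF lim q(2)] obtain n0
    where n0: "\<And>n. n \<ge> n0 \<Longrightarrow> q < - ln (\<Phi> n) / ln (real n)"
    by (auto simp: eventually_sequentially)
  have small: "\<Phi> (j ^ r) \<le> 1 / real j" if j: "j \<ge> max n0 2" for j
  proof -
    have j2: "real j > 1" using j by simp
    have "j ^ 1 \<le> j ^ r" using j r(1) by (intro power_increasing) auto
    then have "q < - ln (\<Phi> (j ^ r)) / ln (real (j ^ r))" using j by (intro n0) auto
    with r(2) have "inverse (real r) < - ln (\<Phi> (j ^ r)) / ln (real (j ^ r))" by linarith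
    also have "ln (real (j ^ r)) = real r * ln (real j)"
      using j2 by (simp add: ln_realpow)
    finally have "ln (real j) < - ln (\<Phi> (j ^ r))"
      using r(1) j2 by (simp add: field_simps)
    then have "ln (\<Phi> (j ^ r)) < ln (1 / real j)" using j2 by (simp add: ln_div)
    then show ?thesis using \<Phi>[of "j ^ r"] j2 by (simp add: less_imp_le)
  qed
  have "decays_along_powers r (max n0 2)"
    unfolding decays_along_powers_def
  proof (intro allI impI)
    fix j and f g :: "'n torus \<Rightarrow> real" assume j: "max n0 2 \<le> j" and fg: "is_lipschitz f" "is_lipschitz g"
    have nonneg: "0 \<le> lipschitz_norm h" if h: "is_lipschitz h" for h :: "'n torus \<Rightarrow> real"
    proof -
      obtain l where l: "l-lipschitz_on UNIV h" using h by (auto simp: is_lipschitz_def)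
      have "bounded (range h)"
        using lipschitz_on_continuous_on[OF l] compact_torus
        by (intro compact_imp_bounded compact_continuous_image)
      then obtain B where "\<And>x. \<bar>h x\<bar> \<le> B" by (auto simp: bounded_iff)
      with l show ?thesis by (rule lipschitz_norm_le)
    qed
    have "lipschitz_norm f * lipschitz_norm g * \<Phi> (j ^ r) \<le> lipschitz_norm f * lipschitz_norm g * (1 / real j)"
      using small[OF j] fg by (intro mult_left_mono mult_nonneg_nonneg nonneg)
    with corr[OF fg, of "j ^ r"]
    show "\<bar>(\<integral>x. f ((F 1 ^^ (j ^ r)) x) * g x \<partial>\<mu>) - (\<integral>x. f x \<partial>\<mu>) * (\<integral>x. g x \<partial>\<mu>)\<bar>
        \<le> lipschitz_norm f * lipschitz_norm g * (1 / real j)"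
      by (rule order_trans)
  qed
  then show False using no_power_decay by blast
qed

theorem theoremD:
  fixes \<alpha> :: "real ^ ('n::finite)"
    and \<phi> :: "'n torus \<Rightarrow> real"
    and F :: "real \<Rightarrow> 'n torus \<Rightarrow> 'n torus"
    and T :: "'n torus \<Rightarrow> 'n torus"
    and i :: 'n
    and \<gamma> p :: ereal
  assumes "rationally_independent \<alpha>"
    and "torus_smooth \<phi>" and "\<And>x. 0 < \<phi> x"
    and "generates_flow (\<lambda>x. \<phi> x *\<^sub>R \<alpha>) F"
    and "T = F 1"
    and "\<alpha> $ i \<notin> \<rat>" and "irrational_type (\<alpha> $ i) = \<gamma>"
    and "\<gamma> > ereal (real CARD('n))"
    and "power_law_decay (reparam_measure \<phi>) T p"
  shows "p \<le> ereal (2 * real CARD('n) + 2) / (\<gamma> - ereal (real CARD('n)))"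
proof -
  have "reparametrized_flow \<alpha> \<phi> F"
    using assms(2-4) by unfold_locales
  with assms(5,9) have "p \<le> 0"
    by (intro power_law_decay_exponent_le_0) auto
  also have "0 \<le> ereal (2 * real CARD('n) + 2) / (\<gamma> - ereal (real CARD('n)))"
  proof -
    have "0 < \<gamma> - ereal (real CARD('n))" using assms(8) by (simp add: ereal_minus_less_iff ereal_less_minus_iff)
    then have "0 \<le> ereal (2 * real CARD('n) + 2) * inverse (\<gamma> - ereal (real CARD('n)))"
      by (intro ereal_0_le_mult ereal_inverse_nonneg_iff[THEN iffD2]) auto
    then show ?thesis by (simp add: divide_ereal_def)
  qed
  finally show ?thesis .
qed

end
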